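(* There is an absolute constant $C>0$ such that for every complete bipartite graph $K(N_1,N_2)$ with a marked vertex $m$, there is a quantum search algorithm that deterministically (with success probability exactly $1$) finds the marked vertex using at most $C\sqrt{N_1+N_2}$ calls to the search operator $e^{-i\theta|m\rangle\langle m|}$.
   Context: The complete bipartite graph $K(N_1,N_2)$ has vertex set partitioned into $V_1$ with $|V_1|=N_1$ and $V_2$ with $|V_2|=N_2$, with an edge between every vertex of $V_1$ and every vertex of $V_2$ and no other edges. States live in the Hilbert space spanned by the orthonormal vertex basis $\{|v\rangle\}$. The algorithm uses continuous-time quantum walk operators $e^{-iAt}$ ($A$ the adjacency matrix of the graph, $t\in\mathbb R$) and search operators $e^{-i\theta|m\rangle\langle m|}$ ($\theta\in\mathbb R$); the marked vertex is accessible only through the search operator, so the algorithm's parameters do not depend on which vertex is marked. *)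

theory Defs
  imports Complex_Main
begin

text \<open>States: functions from vertices (natural numbers) to complex amplitudes.
  The vertex set of K(N1,N2) is {0..<N1+N2}; V1 = {0..<N1}, V2 = {N1..<N1+N2}.\<close>

type_synonym state = "nat \<Rightarrow> complex"

definition kb_vertices :: "nat \<Rightarrow> nat \<Rightarrow> nat set" where
  "kb_vertices N1 N2 = {0..<N1+N2}"

definition kb_adj :: "nat \<Rightarrow> nat \<Rightarrow> nat \<Rightarrow> nat \<Rightarrow> bool" where
  "kb_adj N1 N2 u v \<longleftrightarrow> u \<in> kb_vertices N1 N2 \<and> v \<in> kb_vertices N1 N2 \<and> ((u < N1) \<noteq> (v < N1))"

definition adj_op :: "nat \<Rightarrow> nat \<Rightarrow> state \<Rightarrow> state" where
  "adj_op N1 N2 \<psi> = (\<lambda>v. \<Sum>u\<in>kb_vertices N1 N2. (if kb_adj N1 N2 v u then 1 else 0) * \<psi> u)"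

definition op_exp :: "(state \<Rightarrow> state) \<Rightarrow> state \<Rightarrow> state" where
  "op_exp H \<psi> = (\<lambda>v. \<Sum>k. (H ^^ k) \<psi> v / of_nat (fact k))"

definition walk_op :: "nat \<Rightarrow> nat \<Rightarrow> real \<Rightarrow> state \<Rightarrow> state" where
  "walk_op N1 N2 t = op_exp (\<lambda>\<psi> v. - \<i> * complex_of_real t * adj_op N1 N2 \<psi> v)"

definition search_op :: "nat \<Rightarrow> real \<Rightarrow> state \<Rightarrow> state" where
  "search_op m \<theta> = op_exp (\<lambda>\<psi> v. - \<i> * complex_of_real \<theta> * (if v = m then \<psi> m else 0))"

datatype step = Walk real | Search real

fun apply_step :: "nat \<Rightarrow> nat \<Rightarrow> nat \<Rightarrow> step \<Rightarrow> state \<Rightarrow> state" where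
  "apply_step N1 N2 m (Walk t) \<psi> = walk_op N1 N2 t \<psi>"
| "apply_step N1 N2 m (Search \<theta>) \<psi> = search_op m \<theta> \<psi>"

definition run_alg :: "nat \<Rightarrow> nat \<Rightarrow> nat \<Rightarrow> step list \<Rightarrow> state \<Rightarrow> state" where
  "run_alg N1 N2 m ops \<psi>0 = foldl (\<lambda>\<psi> s. apply_step N1 N2 m s \<psi>) \<psi>0 ops"

fun is_search :: "step \<Rightarrow> bool" where
  "is_search (Search _) = True"
| "is_search (Walk _) = False"

definition num_search_calls :: "step list \<Rightarrow> nat" where
  "num_search_calls ops = length (filter is_search ops)"

definition valid_init :: "nat \<Rightarrow> nat \<Rightarrow> state \<Rightarrow> bool" where
  "valid_init N1 N2 \<psi> \<longleftrightarrow> (\<forall>v. v \<notin> kb_vertices N1 N2 \<longrightarrow> \<psi> v = 0)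
     \<and> (\<Sum>v\<in>kb_vertices N1 N2. (cmod (\<psi> v))\<^sup>2) = 1"

end

theory Submission
  imports Defs "HOL-Library.Product_Plus"
begin

text \<open>For \<open>m\<close> on a side with \<open>n\<close> vertices the evolution stays in the span of the uniform states of the two
  sides and of the vector \<open>s\<close> on the side of \<open>m\<close> with \<open>m = cos \<beta> s + sin \<beta> u\<close>, where \<open>u\<close> is uniform on
  that side and \<open>sin \<beta> = 1 / sqrt n\<close>. A walk of angle \<open>\<pi>\<close> together with searches acts as Grover
  rotations by \<open>2 \<beta>\<close> on the side of \<open>m\<close>, and an intermediate value argument replaces the last,
  overshooting rotation by an exact one; so \<open>O(sqrt n)\<close> searches take \<open>m\<close> exactly to \<open>u\<close>.

  One program must serve both sides. Let \<open>w\<close> carry \<open>m\<close> to the uniform state when \<open>m\<close> is on the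
  first side. Conjugating a search by \<open>w\<close> changes only the phase of the first uniform state in
  that case, so a suitable two-parameter family of initial states is taken to the second
  uniform state. The free phase is chosen, again by the intermediate value theorem, such that
  for \<open>m\<close> on the second side the amplitude on the first side has the modulus that it has after
  \<open>w\<close> and a quarter walk on \<open>m\<close>. Programs of walks of angle \<open>\<pi>\<close> and searches are trivial in
  the first case and can match the states in the second. Undoing \<open>w\<close> then gives \<open>m\<close> in both.
  A side of size two cannot be steered in this way and has to be taken as the first side.\<close>

section \<open>Walks and searches on three amplitudes\<close>

type_synonym amps = "complex \<times> complex \<times> complex"

abbreviation ccos :: "real \<Rightarrow> complex" where "ccos a \<equiv> complex_of_real (cos a)"
abbreviation csin :: "real \<Rightarrow> complex" where "csin a \<equiv> complex_of_real (sin a)"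

text \<open>A triple holds the amplitudes along \<open>s\<close>, along the uniform state of the side of \<open>m\<close>, and along
  the other uniform state; walks are measured by the angle \<open>t * sqrt (N1 * N2)\<close>.\<close>

fun act :: "real \<Rightarrow> step \<Rightarrow> amps \<Rightarrow> amps" where
  "act \<beta> (Walk a) (X, Y, z) =
     (X, ccos a * Y - \<i> * csin a * z, ccos a * z - \<i> * csin a * Y)"
| "act \<beta> (Search \<theta>) (X, Y, z) =
     (X + (cis (-\<theta>) - 1) * (ccos \<beta> * X + csin \<beta> * Y) * ccos \<beta>,
      Y + (cis (-\<theta>) - 1) * (ccos \<beta> * X + csin \<beta> * Y) * csin \<beta>, z)"

definition run :: "real \<Rightarrow> step list \<Rightarrow> amps \<Rightarrow> amps" where
  "run \<beta> p v = fold (act \<beta>) p v"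

fun scl :: "complex \<Rightarrow> amps \<Rightarrow> amps" where
  "scl c (X, Y, z) = (c * X, c * Y, c * z)"

fun ip :: "amps \<Rightarrow> amps \<Rightarrow> complex" where
  "ip (X, Y, z) (X', Y', z') = cnj X * X' + cnj Y * Y' + cnj z * z'"

definition marked :: "real \<Rightarrow> amps" where
  "marked \<beta> = (ccos \<beta>, csin \<beta>, 0)"

text \<open>Coordinates along the marked vector, along the orthogonal unit vector
  \<open>(sin \<beta>, - cos \<beta>, 0)\<close> and along the other uniform state. The change of
  basis is a reflection, hence its own inverse, and a search is diagonal in it.\<close>

definition frame :: "real \<Rightarrow> complex \<Rightarrow> complex \<Rightarrow> complex \<Rightarrow> amps" where
  "frame \<beta> h g z = (ccos \<beta> * h + csin \<beta> * g, csin \<beta> * h - ccos \<beta> * g, z)"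

lemma run_simps [simp]:
  "run \<beta> [] v = v"
  "run \<beta> (s # p) v = run \<beta> p (act \<beta> s v)"
  "run \<beta> (p @ q) v = run \<beta> q (run \<beta> p v)"
  by (simp_all add: run_def)

lemma num_search_calls_simps [simp]:
  "num_search_calls [] = 0"
  "num_search_calls (Walk a # p) = num_search_calls p"
  "num_search_calls (Search \<theta> # p) = Suc (num_search_calls p)"
  "num_search_calls (p @ q) = num_search_calls p + num_search_calls q"
  by (simp_all add: num_search_calls_def)

lemma cos_sin_squares_complex:
  "ccos a * ccos a + csin a * csin a = 1"
  by (metis of_real_1 of_real_add of_real_mult power2_eq_square sin_cos_squared_add3)

lemma frame_surj: "(X, Y, z) = frame \<beta> (ccos \<beta> * X + csin \<beta> * Y) (csin \<beta> * X - ccos \<beta> * Y) z"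
  using cos_sin_squares_complex[of \<beta>] unfolding frame_def prod.inject by algebra

lemma obtain_frame: obtains h g z where "v = frame \<beta> h g z"
  by (metis frame_surj prod.exhaust)

lemma marked_frame: "marked \<beta> = frame \<beta> 1 0 0"
  by (simp add: marked_def frame_def)

lemma scl_frame: "scl c (frame \<beta> h g z) = frame \<beta> (c * h) (c * g) (c * z)"
  by (simp add: frame_def algebra_simps)

lemma act_Search_frame: "act \<beta> (Search \<theta>) (frame \<beta> h g z) = frame \<beta> (cis (-\<theta>) * h) g z"
proof -
  have "ccos \<beta> * (ccos \<beta> * h + csin \<beta> * g) + csin \<beta> * (csin \<beta> * h - ccos \<beta> * g) = h"
    using cos_sin_squares_complex[of \<beta>] by algebra
  then show ?thesis
    by (simp add: frame_def algebra_simps)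
qed

lemma act_Walk_pi [simp]: 
  "act \<beta> (Walk pi) (X, Y, z) = (X, -Y, -z)" "act \<beta> (Walk (-pi)) (X, Y, z) = (X, -Y, -z)"
  by simp_all

text \<open>On the first two amplitudes the walk is the reflection in the axis of \<open>s\<close>,
  which makes the angle \<open>\<beta>\<close> with the marked vector; hence the doubled
  angle.\<close>

lemma act_Walk_pi_frame:
  "act \<beta> (Walk pi) (frame \<beta> h g z) =
     frame \<beta> (ccos (2*\<beta>) * h + csin (2*\<beta>) * g) (csin (2*\<beta>) * h - ccos (2*\<beta>) * g) (-z)"
proof -
  have c: "ccos (2*\<beta>) = ccos \<beta> * ccos \<beta> - csin \<beta> * csin \<beta>"
    by (simp add: cos_double power2_eq_square)
  have s: "csin (2*\<beta>) = 2 * csin \<beta> * ccos \<beta>"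
    by (simp add: sin_double)
  show ?thesis
  proof -
    have "ccos \<beta> * ((ccos \<beta> * ccos \<beta> - csin \<beta> * csin \<beta>) * h + 2 * csin \<beta> * ccos \<beta> * g)
        + csin \<beta> * (2 * csin \<beta> * ccos \<beta> * h - (ccos \<beta> * ccos \<beta> - csin \<beta> * csin \<beta>) * g)
        = (ccos \<beta> * ccos \<beta> + csin \<beta> * csin \<beta>) * (ccos \<beta> * h + csin \<beta> * g)"
      by (simp add: algebra_simps)
    moreover have "csin \<beta> * ((ccos \<beta> * ccos \<beta> - csin \<beta> * csin \<beta>) * h + 2 * csin \<beta> * ccos \<beta> * g)
        - ccos \<beta> * (2 * csin \<beta> * ccos \<beta> * h - (ccos \<beta> * ccos \<beta> - csin \<beta> * csin \<beta>) * g)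
        = - ((ccos \<beta> * ccos \<beta> + csin \<beta> * csin \<beta>) * (csin \<beta> * h - ccos \<beta> * g))"
      by (simp add: algebra_simps)
    ultimately show ?thesis
      unfolding frame_def act_Walk_pi c s cos_sin_squares_complex by simp
  qed
qed

section \<open>Unitarity, linearity and inversion of programs\<close>

lemma ip_frame: "ip (frame \<beta> h g z) (frame \<beta> h' g' z') = cnj h * h' + cnj g * g' + cnj z * z'"
  using cos_sin_squares_complex[of \<beta>] unfolding frame_def ip.simps complex_cnj_add complex_cnj_mult
    complex_cnj_diff complex_cnj_complex_of_real
  by algebra

lemma ip_act: "ip (act \<beta> s u) (act \<beta> s v) = ip u v"
proof (cases s)
  case (Walk a)
  obtain X Y z X' Y' z' where uv: "u = (X, Y, z)" "v = (X', Y', z')"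
    by (metis prod.exhaust)
  have "(ccos a * cnj Y + \<i> * csin a * cnj z) * (ccos a * Y' - \<i> * csin a * z')
      + (ccos a * cnj z + \<i> * csin a * cnj Y) * (ccos a * z' - \<i> * csin a * Y')
      = (ccos a * ccos a + csin a * csin a) * (cnj Y * Y' + cnj z * z')"
    by (simp add: algebra_simps)
  then show ?thesis
    unfolding cos_sin_squares_complex using Walk uv by simp
next
  case (Search \<theta>)
  obtain h g z h' g' z' where "u = frame \<beta> h g z" "v = frame \<beta> h' g' z'"
    by (metis obtain_frame)
  moreover have "cnj (cis (-\<theta>)) * cis (-\<theta>) = 1"
    by (simp add: cis_cnj cis_mult)
  ultimately show ?thesis
    using Search by (simp add: act_Search_frame ip_frame)
qed

lemma ip_run: "ip (run \<beta> p u) (run \<beta> p v) = ip u v"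
  by (induction p arbitrary: u v) (simp_all add: ip_act)

lemma act_linear: "act \<beta> s (u + scl c v) = act \<beta> s u + scl c (act \<beta> s v)"
  by (cases s; cases u; cases v) (simp_all add: algebra_simps)

lemma run_linear: "run \<beta> p (u + scl c v) = run \<beta> p u + scl c (run \<beta> p v)"
  by (induction p arbitrary: u v) (simp_all add: act_linear)

lemma run_scl: "run \<beta> p (scl c v) = scl c (run \<beta> p v)"
proof -
  have 0: "scl c 0 = 0" "u + scl (- 1) u = 0" for c u
    by (simp_all add: zero_prod_def split: prod.splits) (cases u; simp)
  \<comment> \<open>Linearity with \<open>c = -1\<close> and both vectors zero.\<close>
  have "run \<beta> p 0 = 0"
    using run_linear[of \<beta> p 0 "-1" 0] by (simp add: 0)
  then show ?thesis
    using run_linear[of \<beta> p 0 c v] by simp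
qed

fun step_inv :: "step \<Rightarrow> step" where
  "step_inv (Walk a) = Walk (-a)"
| "step_inv (Search \<theta>) = Search (-\<theta>)"

definition prog_inv :: "step list \<Rightarrow> step list" where
  "prog_inv p = rev (map step_inv p)"

lemma act_step_inv: "act \<beta> (step_inv s) (act \<beta> s v) = v" "act \<beta> s (act \<beta> (step_inv s) v) = v"
proof -
  have *: "act \<beta> (step_inv s) (act \<beta> s v) = v" for s
  proof (cases s)
    case (Walk a)
    have "ccos a * (ccos a * y - \<i> * csin a * z) + \<i> * csin a * (ccos a * z - \<i> * csin a * y)
        = (ccos a * ccos a + csin a * csin a) * y" for y z
      by (simp add: algebra_simps)
    with Walk show ?thesis
      unfolding cos_sin_squares_complex by (cases v) simp
  next
    case (Search \<theta>)
    then show ?thesis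
      by (rule_tac v = v and \<beta> = \<beta> in obtain_frame)
         (simp add: act_Search_frame mult.assoc[symmetric] cis_mult)
  qed
  show "act \<beta> (step_inv s) (act \<beta> s v) = v"
    by (rule *)
  have "step_inv (step_inv s) = s"
    by (cases s) auto
  then show "act \<beta> s (act \<beta> (step_inv s) v) = v"
    using *[of "step_inv s"] by simp
qed

lemma run_prog_inv [simp]: "run \<beta> (prog_inv p) (run \<beta> p v) = v"
  by (induction p arbitrary: v) (simp_all add: prog_inv_def act_step_inv)

lemma run_prog_inv' [simp]: "run \<beta> p (run \<beta> (prog_inv p) v) = v"
  by (induction p arbitrary: v) (simp_all add: prog_inv_def act_step_inv)

lemma num_search_calls_prog_inv [simp]: "num_search_calls (prog_inv p) = num_search_calls p"
proof -
  have "is_search \<circ> step_inv = is_search"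
    by (rule ext, case_tac x) auto
  then show ?thesis
    by (simp add: num_search_calls_def prog_inv_def rev_filter[symmetric] filter_map)
qed

lemma act_Search_marked:
  "act \<beta> (Search \<theta>) v = v + scl ((cis (-\<theta>) - 1) * ip (marked \<beta>) v) (marked \<beta>)"
  by (cases v) (simp add: marked_def)

text \<open>Lists run from left to right, so this is the search conjugated by \<open>w\<close>. By
  unitarity it multiplies by \<open>cis (-\<theta>)\<close> along the image of the marked vector
  under \<open>w\<close> and fixes the complement.\<close>

lemma run_conjugated_Search:
  "run \<beta> (prog_inv w @ [Search \<theta>] @ w) v
    = v + scl ((cis (-\<theta>) - 1) * ip (run \<beta> w (marked \<beta>)) v) (run \<beta> w (marked \<beta>))"
proof -
  have "ip (marked \<beta>) (run \<beta> (prog_inv w) v) = ip (run \<beta> w (marked \<beta>)) v"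
    using ip_run[of \<beta> w "marked \<beta>" "run \<beta> (prog_inv w) v"] by simp
  then show ?thesis
    by (simp add: act_Search_marked run_linear)
qed

section \<open>Steering onto the marked vertex\<close>

lemma cis_minus_pi: "cis (-pi) = -1"
  by (simp add: complex_eq_iff)

lemma rotate_to_eq:
  assumes "cmod x = cmod y"
  obtains \<theta> where "cis (-\<theta>) * x = y"
proof (cases "x = 0")
  case True
  then show ?thesis using assms that by simp
next
  case False
  then have "y \<noteq> 0" using assms by auto
  then have "cis (Arg (y / x)) = y / x"
    using False assms by (simp add: cis_Arg sgn_div_norm norm_divide)
  then show ?thesis
    using that[of "- Arg (y / x)"] False by simp
qed

lemma intermediate_value_unordered:
  fixes f :: "real \<Rightarrow> real"
  assumes "continuous_on UNIV f" "f a \<le> y" "y \<le> f b"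
  obtains x where "f x = y"
proof (cases "a \<le> b")
  case True
  then show ?thesis
    using IVT'[of f a y b] assms that continuous_on_subset by blast
next
  case False
  then show ?thesis
    using IVT2'[of f a y b] assms that continuous_on_subset by (metis linear top_greatest)
qed

lemma cnj_mult_self: "cnj x * x = complex_of_real ((cmod x)\<^sup>2)"
  using complex_norm_square[of x] by (simp add: mult.commute)

lemma norm_act_frame:
  assumes "act \<beta> s (frame \<beta> h g z) = frame \<beta> h' g' z'"
  shows "(cmod h)\<^sup>2 + (cmod g)\<^sup>2 + (cmod z)\<^sup>2 = (cmod h')\<^sup>2 + (cmod g')\<^sup>2 + (cmod z')\<^sup>2"
proof -
  have "complex_of_real ((cmod h)\<^sup>2 + (cmod g)\<^sup>2 + (cmod z)\<^sup>2)
      = complex_of_real ((cmod h')\<^sup>2 + (cmod g')\<^sup>2 + (cmod z')\<^sup>2)"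
    using ip_act[of \<beta> s "frame \<beta> h g z" "frame \<beta> h g z"] assms
    unfolding assms ip_frame cnj_mult_self of_real_add by simp
  then show ?thesis
    using of_real_eq_iff by blast
qed

text \<open>One search gives \<open>h\<close> the phase of \<open>g\<close>. Without this phase and
  the norm, two non-negative reals remain, the cosine and sine of an angle in the first
  quadrant.\<close>

lemma align_frame:
  obtains \<theta> \<kappa> \<tau> where "0 \<le> \<tau>" "\<tau> \<le> pi / 2"
    "act \<beta> (Search \<theta>) (frame \<beta> h g z) = frame \<beta> (\<kappa> * ccos \<tau>) (\<kappa> * csin \<tau>) z"
proof -
  define N where "N = sqrt ((cmod h)\<^sup>2 + (cmod g)\<^sup>2)"
  \<comment> \<open>The phase of \<open>g\<close>, with 1 as default so that \<open>u\<close> has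
    modulus 1 even if \<open>g = 0\<close>.\<close>
  define u where "u = (if g = 0 then 1 else sgn g)"
  have u: "cmod u = 1" "g = u * cmod g"
    by (auto simp: u_def norm_sgn) (simp add: sgn_div_norm scaleR_conv_of_real)
  obtain \<theta> where \<theta>: "cis (-\<theta>) * h = u * cmod h"
    using rotate_to_eq[of h "u * cmod h"] u by (auto simp: norm_mult)
  have "\<exists>\<tau>. 0 \<le> \<tau> \<and> \<tau> \<le> pi / 2 \<and> cmod h = N * cos \<tau> \<and> cmod g = N * sin \<tau>"
  proof (cases "N = 0")
    case True
    then have "h = 0" "g = 0"
      by (auto simp: N_def sum_power2_eq_zero_iff)
    then show ?thesis using True by (intro exI[of _ 0]) auto
  next
    case False
    then have N: "N > 0" "N\<^sup>2 = (cmod h)\<^sup>2 + (cmod g)\<^sup>2"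
      by (auto simp: N_def less_le)
    have "(cmod h / N)\<^sup>2 + (cmod g / N)\<^sup>2 = ((cmod h)\<^sup>2 + (cmod g)\<^sup>2) / N\<^sup>2"
      by (simp add: power_divide add_divide_distrib)
    also have "\<dots> = 1"
      using N(1) by (simp flip: N(2))
    finally obtain t where "0 \<le> t" "t \<le> pi / 2" "cmod h / N = cos t" "cmod g / N = sin t"
      using sincos_total_pi_half[of "cmod h / N" "cmod g / N"] N by auto
    then show ?thesis using N by (auto simp: field_simps)
  qed
  then obtain \<tau> where \<tau>: "0 \<le> \<tau>" "\<tau> \<le> pi / 2" "cmod h = N * cos \<tau>" "cmod g = N * sin \<tau>"
    by blast
  have "act \<beta> (Search \<theta>) (frame \<beta> h g z) = frame \<beta> (u * N * ccos \<tau>) (u * N * csin \<tau>) z"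
    using \<theta> u(2) \<tau>(3,4) by (simp add: act_Search_frame mult.assoc)
  then show ?thesis
    using that \<tau>(1,2) by blast
qed

section \<open>Grover rotations and the exact last step\<close>

definition spin :: "nat \<Rightarrow> step list" where
  "spin k = concat (replicate k [Walk pi, Search pi])"

text \<open>The reflection by the walk and the sign flip by the search compose, up to sign, to a
  rotation by \<open>2 * \<beta>\<close> towards the marked vector; \<open>z\<close> takes the same
  sign from the walk.\<close>

lemma run_spin:
  "run \<beta> (spin k) (frame \<beta> (\<kappa> * ccos \<tau>) (\<kappa> * csin \<tau>) z)
    = frame \<beta> ((-1) ^ k * \<kappa> * ccos (\<tau> - 2 * real k * \<beta>)) ((-1) ^ k * \<kappa> * csin (\<tau> - 2 * real k * \<beta>)) ((-1) ^ k * z)"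
proof (induction k arbitrary: \<kappa> \<tau> z)
  case 0
  then show ?case by (simp add: spin_def)
next
  case (Suc k)
  have 1: "-(ccos (2*\<beta>) * (\<kappa> * ccos \<tau>) + csin (2*\<beta>) * (\<kappa> * csin \<tau>)) = - \<kappa> * ccos (\<tau> - 2 * \<beta>)"
    by (simp add: cos_diff algebra_simps)
  have 2: "csin (2*\<beta>) * (\<kappa> * ccos \<tau>) - ccos (2*\<beta>) * (\<kappa> * csin \<tau>) = - \<kappa> * csin (\<tau> - 2 * \<beta>)"
    by (simp add: sin_diff algebra_simps)
  have 3: "\<tau> - 2 * \<beta> - 2 * real k * \<beta> = \<tau> - 2 * real (Suc k) * \<beta>"
    by (simp add: algebra_simps)
  have "run \<beta> (spin (Suc k)) (frame \<beta> (\<kappa> * ccos \<tau>) (\<kappa> * csin \<tau>) z)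
      = run \<beta> (spin k) (act \<beta> (Search pi) (act \<beta> (Walk pi) (frame \<beta> (\<kappa> * ccos \<tau>) (\<kappa> * csin \<tau>) z)))"
    by (simp add: spin_def)
  also have "\<dots> = run \<beta> (spin k) (frame \<beta> (- \<kappa> * ccos (\<tau> - 2 * \<beta>)) (- \<kappa> * csin (\<tau> - 2 * \<beta>)) (-z))"
    unfolding act_Walk_pi_frame act_Search_frame 2 1[symmetric] by (simp add: cis_minus_pi)
  also have "\<dots> = frame \<beta> ((-1) ^ Suc k * \<kappa> * ccos (\<tau> - 2 * real (Suc k) * \<beta>))
      ((-1) ^ Suc k * \<kappa> * csin (\<tau> - 2 * real (Suc k) * \<beta>)) ((-1) ^ Suc k * z)"
    unfolding Suc.IH 3 by simp
  finally show ?case .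
qed

text \<open>Read with \<open>x\<close>, \<open>y\<close> as sine and cosine of \<open>\<tau>\<close>
  and \<open>e\<close>, \<open>d\<close> as those of \<open>\<beta>\<close>, this is
  \<open>sin (2 * \<beta>) \<le> sin (2 * \<beta> + \<tau>)\<close> for
  \<open>0 \<le> \<tau> \<le> \<beta>\<close>. The bound on \<open>e\<close> keeps
  \<open>2 * \<beta> + \<tau>\<close> below \<open>pi - 2 * \<beta>\<close>.\<close>

lemma overshoot_bound:
  fixes x y e d :: real
  assumes "0 \<le> x" "x \<le> e" "0 \<le> d" "d \<le> y" "x\<^sup>2 + y\<^sup>2 = 1" "3 * e\<^sup>2 \<le> 1"
  shows "2 * e * d \<le> 2 * e * d * y + (1 - 2 * e\<^sup>2) * x"
proof -
  have "y \<le> 1"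
  proof (rule power2_le_imp_le)
    show "y\<^sup>2 \<le> 1\<^sup>2"
      unfolding one_power2 using assms(5) zero_le_power2[of x] by linarith
  qed simp
  have "e * d * x \<le> e * y * e"
    using assms by (intro mult_mono) auto
  moreover have "(1 - 2 * e\<^sup>2) * (1 + y) \<ge> e\<^sup>2 * (1 + y)"
    using assms by (intro mult_right_mono) auto
  moreover have "e\<^sup>2 * (1 - y) \<ge> 0"
    using \<open>y \<le> 1\<close> by simp
  ultimately have "(1 - 2 * e\<^sup>2) * (1 + y) - 2 * e * d * x \<ge> 0"
    by (simp add: algebra_simps power2_eq_square)
  then have "x * ((1 - 2 * e\<^sup>2) * (1 + y) - 2 * e * d * x) \<ge> 0"
    using assms(1) by simp
  \<comment> \<open>As \<open>(1 - y) * (1 + y) = x\<^sup>2\<close>, the difference of the two sides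
    of the claim acquires the factor \<open>x\<close> when multiplied by
    \<open>1 + y\<close>.\<close>
  moreover have "x * ((1 - 2 * e\<^sup>2) * (1 + y) - 2 * e * d * x)
      = (1 + y) * (2 * e * d * y + (1 - 2 * e\<^sup>2) * x - 2 * e * d) + 2 * e * d * (1 - (x\<^sup>2 + y\<^sup>2))"
    by (simp add: algebra_simps power2_eq_square)
  ultimately have "0 \<le> (1 + y) * (2 * e * d * y + (1 - 2 * e\<^sup>2) * x - 2 * e * d)"
    using assms(5) by simp
  then show ?thesis
    using assms by (simp add: zero_le_mult_iff)
qed

text \<open>A walk of angle \<open>pi\<close> clears the second coordinate exactly when the first
  two are in the ratio of \<open>cos (2 * \<beta>)\<close> to \<open>sin (2 * \<beta>)\<close>. The
  first search and walk produce moduli in this ratio, the second search the phases. The two walks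
  together preserve \<open>z\<close>.\<close>

lemma steer_final:
  assumes \<beta>: "0 < \<beta>" "\<beta> < pi / 2" "3 * (sin \<beta>)\<^sup>2 \<le> 1" and \<tau>: "\<bar>\<tau>\<bar> \<le> \<beta>"
  obtains \<theta> \<phi> \<kappa>' where
    "run \<beta> [Search \<theta>, Walk pi, Search \<phi>, Walk pi] (frame \<beta> (\<kappa> * ccos \<tau>) (\<kappa> * csin \<tau>) z)
      = frame \<beta> \<kappa>' 0 z"
proof -
  define S where "S = sin (2 * \<beta>)"
  define C where "C = cos (2 * \<beta>)"
  define x where "x = \<bar>sin \<tau>\<bar>"
  define y where "y = cos \<tau>"
  define e where "e = sin \<beta>"
  define d where "d = cos \<beta>"
  have S: "S = 2 * e * d" and C: "C = 1 - 2 * e\<^sup>2"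
    by (simp_all add: S_def C_def e_def d_def sin_double cos_double_sin)
  have pos: "e > 0" "d > 0"
    using \<beta> by (auto simp: e_def d_def sin_gt_zero cos_gt_zero)
  have ed: "e\<^sup>2 + d\<^sup>2 = 1" "x\<^sup>2 + y\<^sup>2 = 1"
    by (simp_all add: e_def d_def x_def y_def)
  have "sin \<bar>\<tau>\<bar> \<le> e"
    unfolding e_def using \<beta> \<tau> by (intro sin_monotone_2pi_le) auto
  moreover have "x = sin \<bar>\<tau>\<bar>"
    unfolding x_def using \<beta> \<tau> sin_ge_zero[of "\<bar>\<tau>\<bar>"] by (cases "\<tau> \<ge> 0") auto
  ultimately have xe: "x \<le> e" "0 \<le> x"
    by (auto simp: x_def)
  have "cos \<bar>\<tau>\<bar> \<ge> d"
    unfolding d_def using \<beta> \<tau> by (intro cos_monotone_0_pi_le) auto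
  then have yd: "d \<le> y"
    by (simp add: y_def)
  have e3: "3 * e\<^sup>2 \<le> 1"
    using \<beta> by (simp add: e_def)
  have up: "S \<le> S * y + C * x"
    unfolding S C using overshoot_bound[of x e d y] xe yd pos ed e3 by simp
  have "C \<ge> 0" "C \<le> 1"
    using e3 by (auto simp: C)
  have "S > 0"
    using pos by (simp add: S)
  have "y \<le> 1"
    by (simp add: y_def)
  have "S * y \<le> S"
    using \<open>S > 0\<close> \<open>y \<le> 1\<close> by simp
  \<comment> \<open>Yields \<open>C * x \<le> e \<le> 2 * e * d = S\<close>, which keeps the smaller
    endpoint value of \<open>f\<close> below \<open>S\<close>.\<close>
  have "d \<ge> 1/2"
  proof (rule ccontr)
    assume "\<not> d \<ge> 1/2"
    then have "d\<^sup>2 < (1/2)\<^sup>2"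
      using pos by (intro power_strict_mono) auto
    then show False
      using ed e3 by (simp add: power_divide)
  qed
  then have "C * x \<le> 1 * e" "e * 1 \<le> e * (2 * d)"
    using \<open>C \<le> 1\<close> \<open>C \<ge> 0\<close> xe pos by (intro mult_mono; simp)+
  then have "C * x \<le> S"
    by (simp add: S)
  have nn: "C * x \<ge> 0" "S * y \<ge> 0"
    using \<open>C \<ge> 0\<close> xe \<open>S > 0\<close> yd pos by auto
  define f where "f = (\<lambda>\<theta>. cmod (S * cis (-\<theta>) * y - C * sin \<tau>))"
  have f0: "f 0 = \<bar>S * y - C * sin \<tau>\<bar>"
    unfolding f_def by (simp flip: of_real_mult of_real_diff)
  have "f pi = cmod (complex_of_real (- (S * y + C * sin \<tau>)))"
    unfolding f_def by (simp add: cis_minus_pi)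
  then have fpi: "f pi = \<bar>S * y + C * sin \<tau>\<bar>"
    by (simp only: norm_of_real abs_minus_cancel)
  have cont: "continuous_on UNIV f"
    unfolding f_def by (intro continuous_intros)
  \<comment> \<open>Up to the factor \<open>cmod \<kappa>\<close>, \<open>f \<theta>\<close> is the
    modulus of the second coordinate after the first walk. At one of the phases \<open>0\<close> and
    \<open>pi\<close> its two terms add and reach \<open>S\<close>, at the other they subtract and
    stay below; the sign of \<open>sin \<tau>\<close> decides which.\<close>
  obtain \<theta> where \<theta>: "f \<theta> = S"
  proof (cases "sin \<tau> \<ge> 0")
    case True
    then have "x = sin \<tau>" by (simp add: x_def)
    then have "f 0 \<le> S" "S \<le> f pi"
      using f0 fpi up nn \<open>S * y \<le> S\<close> \<open>C * x \<le> S\<close> by auto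
    then show ?thesis
      using intermediate_value_unordered[OF cont] that by blast
  next
    case False
    then have "sin \<tau> = - x" by (simp add: x_def)
    then have "f pi \<le> S" "S \<le> f 0"
      using f0 fpi up nn \<open>S * y \<le> S\<close> \<open>C * x \<le> S\<close> by auto
    then show ?thesis
      using intermediate_value_unordered[OF cont] that by blast
  qed
  define h where "h = C * (cis (-\<theta>) * (\<kappa> * ccos \<tau>)) + S * (\<kappa> * csin \<tau>)"
  define g where "g = S * (cis (-\<theta>) * (\<kappa> * ccos \<tau>)) - C * (\<kappa> * csin \<tau>)"
  have s1: "act \<beta> (Search \<theta>) (frame \<beta> (\<kappa> * ccos \<tau>) (\<kappa> * csin \<tau>) z)
      = frame \<beta> (cis (-\<theta>) * (\<kappa> * ccos \<tau>)) (\<kappa> * csin \<tau>) z"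
    by (rule act_Search_frame)
  have s2: "act \<beta> (Walk pi) (frame \<beta> (cis (-\<theta>) * (\<kappa> * ccos \<tau>)) (\<kappa> * csin \<tau>) z) = frame \<beta> h g (-z)"
    unfolding act_Walk_pi_frame h_def g_def S_def C_def ..
  have "g = \<kappa> * (S * cis (-\<theta>) * y - C * sin \<tau>)"
    by (simp add: g_def y_def algebra_simps)
  then have g: "cmod g = cmod \<kappa> * S"
    using \<theta> by (simp add: f_def norm_mult)
  have "(cmod h)\<^sup>2 + (cmod g)\<^sup>2 = (cmod \<kappa>)\<^sup>2 * ((cos \<tau>)\<^sup>2 + (sin \<tau>)\<^sup>2)"
    using norm_act_frame[OF s2] unfolding distrib_left by (simp add: norm_mult power_mult_distrib)
  then have "(cmod h)\<^sup>2 = (cmod \<kappa>)\<^sup>2 * (1 - S\<^sup>2)"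
    by (simp add: g power_mult_distrib algebra_simps)
  also have "1 - S\<^sup>2 = C\<^sup>2"
    by (simp add: S_def C_def cos_squared_eq)
  finally have "(cmod h)\<^sup>2 = (cmod \<kappa> * C)\<^sup>2"
    by (simp add: power_mult_distrib)
  then have h: "cmod h = cmod \<kappa> * C"
    using \<open>C \<ge> 0\<close> by (simp add: power2_eq_iff_nonneg)
  then have "cmod (S * h) = cmod (C * g)"
    using g \<open>C \<ge> 0\<close> \<open>S > 0\<close> by (simp add: norm_mult)
  then obtain \<phi> where \<phi>: "cis (-\<phi>) * (S * h) = C * g"
    by (rule rotate_to_eq)
  have "csin (2*\<beta>) * (cis (-\<phi>) * h) - ccos (2*\<beta>) * g = 0"
    using \<phi> by (simp add: S_def C_def algebra_simps)
  then have "run \<beta> [Search \<theta>, Walk pi, Search \<phi>, Walk pi] (frame \<beta> (\<kappa> * ccos \<tau>) (\<kappa> * csin \<tau>) z)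
      = frame \<beta> (ccos (2*\<beta>) * (cis (-\<phi>) * h) + csin (2*\<beta>) * g) 0 z"
    unfolding run_simps s1 s2 unfolding act_Search_frame act_Walk_pi_frame by simp
  then show ?thesis
    by (rule that)
qed

section \<open>Programs whose walks have angle \<open>pi\<close> or \<open>-pi\<close>\<close>

definition quiet :: "step list \<Rightarrow> bool" where
  "quiet p \<longleftrightarrow> (\<forall>s\<in>set p. s = Walk pi \<or> s = Walk (-pi) \<or> is_search s)"

lemma quiet_simps [simp]:
  "quiet []" "quiet (p @ q) \<longleftrightarrow> quiet p \<and> quiet q"
  "quiet (Search \<theta> # p) \<longleftrightarrow> quiet p" "quiet (Walk pi # p) \<longleftrightarrow> quiet p"
  by (auto simp: quiet_def)

lemma quiet_spin [simp]: "quiet (spin k)"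
  by (auto simp: quiet_def spin_def)

lemma quiet_prog_inv [simp]: "quiet p \<Longrightarrow> quiet (prog_inv p)"
  unfolding quiet_def prog_inv_def
proof (intro ballI)
  fix s assume p: "\<forall>s\<in>set p. s = Walk pi \<or> s = Walk (-pi) \<or> is_search s" and "s \<in> set (rev (map step_inv p))"
  then obtain r where r: "r \<in> set p" "s = step_inv r" by auto
  show "s = Walk pi \<or> s = Walk (-pi) \<or> is_search s"
    using p[rule_format, OF r(1)] r(2) by (cases r) auto
qed

text \<open>Searches fix the last amplitude and each walk negates it, so \<open>\<sigma>\<close> is
  a sign given by the number of walks, the same for every \<open>\<beta>\<close>. On the other
  uniform state the program is trivial up to this sign.\<close>

lemma quiet_run:
  assumes "quiet p"
  obtains \<sigma> :: complex where "\<sigma> * \<sigma> = 1"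
    "\<And>\<beta> X Y z. \<exists>X' Y'. run \<beta> p (X, Y, z) = (X', Y', \<sigma> * z)"
    "\<And>\<beta> z. run \<beta> p (0, 0, z) = (0, 0, \<sigma> * z)"
proof -
  have "\<exists>\<sigma>::complex. \<sigma> * \<sigma> = 1 \<and> (\<forall>\<beta> X Y z. \<exists>X' Y'. run \<beta> p (X, Y, z) = (X', Y', \<sigma> * z))
      \<and> (\<forall>\<beta> z. run \<beta> p (0, 0, z) = (0, 0, \<sigma> * z))"
    using assms
  proof (induction p)
    case Nil
    show ?case by (intro exI[of _ 1]) simp
  next
    case (Cons s p)
    then obtain \<sigma> :: complex where \<sigma>: "\<sigma> * \<sigma> = 1"
      "\<And>\<beta> X Y z. \<exists>X' Y'. run \<beta> p (X, Y, z) = (X', Y', \<sigma> * z)"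
      "\<And>\<beta> z. run \<beta> p (0, 0, z) = (0, 0, \<sigma> * z)"
      by (auto simp: quiet_def)
    show ?case
    proof (cases "is_search s")
      case True
      then obtain \<theta> where "s = Search \<theta>" by (cases s) auto
      then show ?thesis
        using \<sigma> by (intro exI[of _ \<sigma>]) simp
    next
      case False
      then have s: "act \<beta> s (X, Y, z) = (X, -Y, -z)" for \<beta> X Y z
        using Cons.prems by (auto simp: quiet_def)
      show ?thesis
        using \<sigma>(1) \<sigma>(2)[of _ _ _ "- _"] \<sigma>(3)[of _ "- _"] by (intro exI[of _ "-\<sigma>"]) (simp add: s)
    qed
  qed
  then show ?thesis using that by blast
qed

lemma num_search_calls_spin [simp]: "num_search_calls (spin k) = k"
  by (induction k) (simp_all add: spin_def)

text \<open>One search aligns the phases, \<open>k\<close> rotations come within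
  \<open>\<beta>\<close> of the marked vector, and two more searches land on it.\<close>

lemma steer:
  assumes \<beta>: "0 < \<beta>" "\<beta> < pi / 2" "3 * (sin \<beta>)\<^sup>2 \<le> 1"
  obtains p \<kappa> z' where "quiet p" "run \<beta> p v = frame \<beta> \<kappa> 0 z'" "real (num_search_calls p) \<le> 1 / \<beta> + 4"
proof -
  obtain h g z where v: "v = frame \<beta> h g z"
    by (rule obtain_frame)
  obtain \<theta>0 \<kappa> \<tau> where \<tau>: "0 \<le> \<tau>" "\<tau> \<le> pi / 2"
    and 0: "act \<beta> (Search \<theta>0) v = frame \<beta> (\<kappa> * ccos \<tau>) (\<kappa> * csin \<tau>) z"
    unfolding v by (rule align_frame)
  \<comment> \<open>The integer nearest to \<open>\<tau> / (2 * \<beta>)\<close>, leaving an angle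
    of at most \<open>\<beta>\<close> to either side.\<close>
  define k where "k = nat \<lfloor>(\<tau> + \<beta>) / (2 * \<beta>)\<rfloor>"
  have k0: "0 \<le> (\<tau> + \<beta>) / (2 * \<beta>)"
    using \<tau> \<beta> by simp
  then have "real k \<le> (\<tau> + \<beta>) / (2 * \<beta>)" "(\<tau> + \<beta>) / (2 * \<beta>) < real k + 1"
    unfolding k_def by linarith+
  then have k: "2 * real k * \<beta> \<le> \<tau> + \<beta>" "\<tau> + \<beta> < 2 * real k * \<beta> + 2 * \<beta>"
    using \<beta> by (simp_all add: field_simps)
  have "\<bar>\<tau> - 2 * real k * \<beta>\<bar> \<le> \<beta>"
    using k by linarith
  from steer_final[OF \<beta> this]
  obtain \<theta> \<phi> \<kappa>' where 1: "run \<beta> [Search \<theta>, Walk pi, Search \<phi>, Walk pi]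
      (frame \<beta> ((-1) ^ k * \<kappa> * ccos (\<tau> - 2 * real k * \<beta>)) ((-1) ^ k * \<kappa> * csin (\<tau> - 2 * real k * \<beta>)) ((-1) ^ k * z))
      = frame \<beta> \<kappa>' 0 ((-1) ^ k * z)"
    by blast
  let ?p = "[Search \<theta>0] @ spin k @ [Search \<theta>, Walk pi, Search \<phi>, Walk pi]"
  have "run \<beta> ?p v = frame \<beta> \<kappa>' 0 ((-1) ^ k * z)"
    using 1 unfolding run_simps(3) run_spin 0 by (simp only: run_simps(1,2) 0 run_spin)
  moreover have "real k \<le> 1 / \<beta> + 1"
  proof -
    have "2 * real k * \<beta> \<le> 2 + 2 * \<beta>"
      using k(1) \<tau>(2) pi_less_4 \<beta> by linarith
    then show ?thesis
      using \<beta> by (simp add: field_simps)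
  qed
  ultimately show ?thesis
    using that[of ?p] by simp
qed

section \<open>One program for both sides\<close>

lemma ip_marked [simp]: "ip (marked \<beta>) (marked \<beta>) = 1"
  by (simp add: marked_frame ip_frame)

text \<open>Steering both states leaves \<open>\<kappa>\<close> and \<open>y\<close> in each. The
  moduli of the \<open>y\<close> agree as quiet programs preserve them, those of the
  \<open>\<kappa>\<close> by unitarity; one search then adjusts the relative phase, and the second
  steering is undone.\<close>

lemma connect:
  assumes "quiet p" "run \<beta> p (X, Y, z) = frame \<beta> \<kappa> 0 y"
    and "quiet p'" "run \<beta> p' (X', Y', z') = frame \<beta> \<kappa>' 0 y'"
    and "ip (X, Y, z) (X, Y, z) = ip (X', Y', z') (X', Y', z')" "cmod z = cmod z'"
  obtains q c where "quiet q" "cmod c = 1" "run \<beta> q (X, Y, z) = scl c (X', Y', z')"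
    "num_search_calls q = num_search_calls p + num_search_calls p' + 1"
proof -
  obtain \<sigma> :: complex where \<sigma>: "\<sigma> * \<sigma> = 1" "\<exists>X' Y'. run \<beta> p (X, Y, z) = (X', Y', \<sigma> * z)"
    by (rule quiet_run[OF assms(1)]) blast
  obtain \<sigma>' :: complex where \<sigma>': "\<sigma>' * \<sigma>' = 1" "\<exists>X Y. run \<beta> p' (X', Y', z') = (X, Y, \<sigma>' * z')"
    by (rule quiet_run[OF assms(3)]) blast
  have "cmod \<sigma> = 1" "cmod \<sigma>' = 1"
    using \<sigma>(1) \<sigma>'(1) by (auto simp: square_eq_1_iff)
  have y: "y = \<sigma> * z" "y' = \<sigma>' * z'"
    using \<sigma>(2) \<sigma>'(2) assms(2,4) by (auto simp: frame_def)
  then have cy: "cmod y = cmod y'"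
    using \<open>cmod \<sigma> = 1\<close> \<open>cmod \<sigma>' = 1\<close> assms(6) by (simp add: norm_mult)
  have "ip (frame \<beta> \<kappa> 0 y) (frame \<beta> \<kappa> 0 y) = ip (frame \<beta> \<kappa>' 0 y') (frame \<beta> \<kappa>' 0 y')"
    using assms(2,4,5) ip_run by metis
  then have "complex_of_real ((cmod \<kappa>)\<^sup>2) = complex_of_real ((cmod \<kappa>')\<^sup>2)"
    using cy unfolding ip_frame cnj_mult_self by simp
  then have "cmod \<kappa> = cmod \<kappa>'"
    by (simp add: power2_eq_iff_nonneg flip: of_real_power)
  \<comment> \<open>The global phase is read off the last amplitudes; if they vanish it is
    free.\<close>
  obtain c where c: "cmod c = 1" "y = c * y'"
  proof (cases "y' = 0")
    case True
    then show ?thesis using cy that[of 1] by simp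
  next
    case False
    then show ?thesis using cy that[of "y / y'"] by (simp add: norm_divide)
  qed
  have "cmod \<kappa> = cmod (c * \<kappa>')"
    using c \<open>cmod \<kappa> = cmod \<kappa>'\<close> by (simp add: norm_mult)
  then obtain \<theta> where \<theta>: "cis (-\<theta>) * \<kappa> = c * \<kappa>'"
    by (rule rotate_to_eq)
  let ?q = "p @ [Search \<theta>] @ prog_inv p'"
  have "run \<beta> ?q (X, Y, z) = run \<beta> (prog_inv p') (scl c (frame \<beta> \<kappa>' 0 y'))"
    using assms(2) \<theta> c by (simp add: act_Search_frame scl_frame)
  also have "\<dots> = scl c (run \<beta> (prog_inv p') (run \<beta> p' (X', Y', z')))"
    unfolding run_scl assms(4) ..
  finally have "run \<beta> ?q (X, Y, z) = scl c (X', Y', z')"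
    by simp
  then show ?thesis
    using that[of ?q c] c assms(1,3) by simp
qed

section \<open>From the marked vertex to the uniform state of its side\<close>

definition side_angle :: "nat \<Rightarrow> real" where
  "side_angle n = arcsin (1 / sqrt n)"

lemma side_angle:
  assumes "n \<ge> 1"
  shows "sin (side_angle n) = 1 / sqrt n" "cos (side_angle n) = sqrt (1 - 1 / n)" "0 < side_angle n"
    "side_angle n \<le> pi / 2" "1 / side_angle n \<le> sqrt n"
proof -
  have le: "0 < 1 / sqrt n" "1 / sqrt n \<le> 1" "-1 \<le> 1 / sqrt n"
    using assms by (auto intro: order_trans[of _ 0])
  then show s: "sin (side_angle n) = 1 / sqrt n"
    unfolding side_angle_def by (intro sin_arcsin) auto
  show "cos (side_angle n) = sqrt (1 - 1 / n)"
    unfolding side_angle_def using le by (subst cos_arcsin) (auto simp: power_divide)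
  have "arcsin 0 < arcsin (1 / sqrt n)"
    using le by (intro arcsin_less_arcsin) auto
  then show pos: "0 < side_angle n"
    by (simp add: side_angle_def)
  show "side_angle n \<le> pi / 2"
    unfolding side_angle_def using le by (intro arcsin_ubound) auto
  have "1 / sqrt n \<le> side_angle n"
    using sin_x_le_x[of "side_angle n"] pos s by simp
  then have "1 / side_angle n \<le> 1 / (1 / sqrt n)"
    using le(1) pos by (intro divide_left_mono mult_pos_pos) simp_all
  then show "1 / side_angle n \<le> sqrt n"
    by simp
qed

text \<open>The squared sine is \<open>1 / n\<close>, so the steering condition is exactly
  \<open>n \<ge> 3\<close>.\<close>

lemma side_angle_steerable:
  assumes "n \<ge> 3"
  shows "0 < side_angle n" "side_angle n < pi / 2" "3 * (sin (side_angle n))\<^sup>2 \<le> 1"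
proof -
  have n: "n \<ge> 1" using assms by simp
  show "0 < side_angle n" by (rule side_angle(3)[OF n])
  show *: "3 * (sin (side_angle n))\<^sup>2 \<le> 1"
    using assms by (simp add: side_angle(1)[OF n] power_divide divide_simps)
  have "side_angle n \<noteq> pi / 2"
  proof
    assume "side_angle n = pi / 2"
    then have "sin (side_angle n) = 1" by (simp only: sin_pi_half)
    with * show False by simp
  qed
  then show "side_angle n < pi / 2"
    using side_angle(4)[OF n] by simp
qed

lemma marked_to_uniform:
  assumes "n \<ge> 1"
  obtains w u where "run (side_angle n) w (marked (side_angle n)) = (0, u, 0)" "cmod u = 1"
    "real (num_search_calls w) \<le> sqrt n + 4"
proof -
  let ?\<beta> = "side_angle n"
  have "\<exists>w u. run ?\<beta> w (marked ?\<beta>) = (0, u, 0) \<and> real (num_search_calls w) \<le> sqrt n + 4"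
  proof -
    consider "n = 1" | "n = 2" | "n \<ge> 3"
      using assms by linarith
    then show ?thesis
    proof cases
      case 1
      then show ?thesis
        by (intro exI[of _ "[]"]) (simp add: marked_def side_angle)
    next
      case 2
      have sq: "1 / sqrt 2 = sqrt 2 / 2" "sqrt (1/2) = sqrt 2 / 2"
        by (simp_all add: real_div_sqrt real_sqrt_divide)
      have m: "cos ?\<beta> = sqrt 2 / 2" "sin ?\<beta> = sqrt 2 / 2"
        using side_angle(1,2)[of n] 2 sq by simp_all
      have s2: "complex_of_real (sqrt 2) * complex_of_real (sqrt 2) = 2"
        "complex_of_real (sqrt 2) * (complex_of_real (sqrt 2) * x) = 2 * x" for x
        by (simp_all flip: of_real_mult mult.assoc)
      \<comment> \<open>The first walk moves the uniform part of the marked vector to the other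
        side. The overlap with the marked vector is then \<open>1/2\<close>, so the sign flip clears
        the amplitude along \<open>s\<close>, and the last walk gathers the rest.\<close>
      have "run ?\<beta> [Walk (pi/2), Search pi, Walk (pi/4)] (marked ?\<beta>) = (0, -1, 0)"
        unfolding marked_def run_simps act.simps m
        by (simp add: cis_minus_pi cos_45 sin_45 s2 algebra_simps)
      then show ?thesis
        by (intro exI[of _ "[Walk (pi/2), Search pi, Walk (pi/4)]"] exI[of _ "-1"]) simp
    next
      case 3
      \<comment> \<open>The uniform state is steered to the marked vertex, without leaving the side,
        and the program is inverted.\<close>
      obtain p \<kappa> z' where p: "quiet p" "run ?\<beta> p (0, 1, 0) = frame ?\<beta> \<kappa> 0 z'"
        "real (num_search_calls p) \<le> 1 / ?\<beta> + 4"
        using side_angle_steerable[OF 3] by (rule steer)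
      from \<open>quiet p\<close> obtain \<sigma> :: complex where "\<exists>X' Y'. run ?\<beta> p (0, 1, 0) = (X', Y', \<sigma> * 0)"
        by (rule quiet_run) blast
      then have "z' = 0"
        using p(2) by (auto simp: frame_def)
      then have "run ?\<beta> p (0, 1, 0) = scl \<kappa> (marked ?\<beta>)"
        using p(2) by (simp add: marked_frame scl_frame)
      then have "(0, 1, 0) = scl \<kappa> (run ?\<beta> (prog_inv p) (marked ?\<beta>))"
        by (metis run_prog_inv run_scl)
      then have "\<exists>u. run ?\<beta> (prog_inv p) (marked ?\<beta>) = (0, u, 0)"
        by (cases "run ?\<beta> (prog_inv p) (marked ?\<beta>)") auto
      moreover have "real (num_search_calls (prog_inv p)) \<le> sqrt n + 4"
        using p(3) side_angle(5)[OF assms] by simp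
      ultimately show ?thesis
        by blast
    qed
  qed
  then obtain w u where wu: "run ?\<beta> w (marked ?\<beta>) = (0, u, 0)" "real (num_search_calls w) \<le> sqrt n + 4"
    by blast
  have "ip (0, u, 0) (0, u, 0) = 1"
    using ip_run[of ?\<beta> w "marked ?\<beta>" "marked ?\<beta>"] wu by simp
  then have "complex_of_real ((cmod u)\<^sup>2) = 1"
    unfolding cnj_mult_self[symmetric] by simp
  then have "(cmod u)\<^sup>2 = 1"
    using of_real_eq_1_iff by blast
  then have "cmod u = 1"
    using norm_ge_zero[of u] unfolding power2_eq_1_iff by linarith
  then show ?thesis
    using that wu by blast
qed

text \<open>The expression below is the last amplitude that \<open>(0, cos \<gamma>, \<i> cis \<phi> sin \<gamma>)\<close> has after multiplying
  its component along a unit vector \<open>(_, r, m)\<close> by \<open>cis (-\<phi>)\<close> and walking by the angle \<open>\<gamma>\<close>. For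
  \<open>\<gamma> = \<plusminus>\<pi>/4\<close> and \<open>\<phi> = \<plusminus>\<pi>/2\<close> it simplifies, and one of the four sign choices is large enough.\<close>

lemma transfer_amplitude_large:
  fixes r m :: complex
  obtains \<gamma> \<phi> :: real where
    "cmod r \<le> cmod (ccos \<gamma> * (\<i> * cis \<phi> * csin \<gamma> + (cis (-\<phi>) - 1) * (cnj r * ccos \<gamma> + cnj m * (\<i> * cis \<phi> * csin \<gamma>)) * m)
       - \<i> * csin \<gamma> * (ccos \<gamma> + (cis (-\<phi>) - 1) * (cnj r * ccos \<gamma> + cnj m * (\<i> * cis \<phi> * csin \<gamma>)) * r))"
proof -
  define q where "q = cnj r * m"
  define A where "A = (cmod m)\<^sup>2"
  define B where "B = (cmod r)\<^sup>2"
  have AB: "(Re q)\<^sup>2 + (Im q)\<^sup>2 = A * B"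
    unfolding cmod_power2[symmetric] q_def A_def B_def by (simp add: norm_mult power_mult_distrib)
  \<comment> \<open>\<open>(Re q + \<delta> * Im q)\<^sup>2\<close> is \<open>A * B\<close> plus
    twice \<open>\<delta> * Re q * Im q\<close>, so one sign suffices.\<close>
  obtain \<delta> :: real where \<delta>: "\<delta> = 1 \<or> \<delta> = -1" "A * B \<le> (Re q + \<delta> * Im q)\<^sup>2"
  proof (cases "Re q * Im q \<ge> 0")
    case True
    then show ?thesis using that[of 1] AB by (simp add: power2_sum mult.commute)
  next
    case False
    then show ?thesis using that[of "-1"] AB by (simp add: power2_diff mult.commute)
  qed
  define t where "t = Re q + \<delta> * Im q"
  \<comment> \<open>Makes the cross term in the square of \<open>cmod F\<close>
    non-negative.\<close>
  obtain \<epsilon> :: real where \<epsilon>: "\<epsilon> = 1 \<or> \<epsilon> = -1" "0 \<le> \<epsilon> * (\<delta> * t * (1 - A - B))"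
    using that[of 1] that[of "-1"] by linarith
  \<comment> \<open>The amplitude at the chosen angles without a factor of modulus
    \<open>1 / sqrt 2\<close>; hence the target \<open>2 * B\<close>.\<close>
  define F where "F = \<epsilon> * \<delta> * (1 - complex_of_real A) + q - \<i> * \<epsilon> * B + \<i> * \<delta> * cnj q"
  have "(cmod F)\<^sup>2 = (\<epsilon> * \<delta> * (1 - A) + Re q + \<delta> * Im q)\<^sup>2 + (Im q - \<epsilon> * B + \<delta> * Re q)\<^sup>2"
    unfolding cmod_power2 by (simp add: F_def)
  also have "\<dots> = (1 - A)\<^sup>2 + B\<^sup>2 + 2 * t\<^sup>2 + 2 * (\<epsilon> * (\<delta> * t * (1 - A - B)))"
    using \<delta>(1) \<epsilon>(1) unfolding t_def by (auto simp: power2_eq_square algebra_simps)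
  also have "\<dots> \<ge> (1 - A)\<^sup>2 + B\<^sup>2 + 2 * (A * B)"
    using \<delta>(2) \<epsilon>(2) unfolding t_def by linarith
  also have "(1 - A)\<^sup>2 + B\<^sup>2 + 2 * (A * B) = (1 - A - B)\<^sup>2 + 2 * B"
    by (simp add: power2_eq_square algebra_simps)
  finally have F: "2 * B \<le> (cmod F)\<^sup>2"
    using zero_le_power2[of "1 - A - B"] by linarith
  define \<gamma> where "\<gamma> = \<epsilon> * (pi / 4)"
  define \<phi> where "\<phi> = \<delta> * (pi / 2)"
  define k where "k = complex_of_real (sqrt 2 / 2)"
  have k: "k * k = 1/2"
    by (simp add: k_def flip: of_real_mult)
  have trig: "ccos \<gamma> = k" "csin \<gamma> = \<epsilon> * k" "cis \<phi> = \<i> * \<delta>" "cis (-\<phi>) = - \<i> * \<delta>"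
    using \<epsilon>(1) \<delta>(1) by (auto simp: \<gamma>_def \<phi>_def k_def cos_45 sin_45 complex_eq_iff)
  let ?z = "ccos \<gamma> * (\<i> * cis \<phi> * csin \<gamma> + (cis (-\<phi>) - 1) * (cnj r * ccos \<gamma> + cnj m * (\<i> * cis \<phi> * csin \<gamma>)) * m)
       - \<i> * csin \<gamma> * (ccos \<gamma> + (cis (-\<phi>) - 1) * (cnj r * ccos \<gamma> + cnj m * (\<i> * cis \<phi> * csin \<gamma>)) * r)"
  have AB': "complex_of_real A = cnj m * m" "complex_of_real B = cnj r * r"
    by (simp_all only: A_def B_def cnj_mult_self)
  have z: "?z = k * k * ((- \<i> * \<delta> - 1) * F)"
    unfolding trig F_def AB' q_def using \<epsilon>(1) \<delta>(1) by (auto simp: algebra_simps)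
  have "(cmod ?z)\<^sup>2 = (1/2)\<^sup>2 * ((cmod (- \<i> * \<delta> - 1))\<^sup>2 * (cmod F)\<^sup>2)"
    unfolding z k norm_mult power_mult_distrib by (simp add: norm_divide)
  also have "(cmod (- \<i> * \<delta> - 1))\<^sup>2 = 2"
    unfolding cmod_power2 using \<delta>(1) by auto
  finally have "B \<le> (cmod ?z)\<^sup>2"
    using F by (simp add: power_divide)
  then have "cmod r \<le> cmod ?z"
    unfolding B_def by (rule power2_le_imp_le) simp
  then show ?thesis
    by (rule that)
qed

text \<open>For the \<open>\<gamma>\<close> found above the amplitude vanishes at
  \<open>\<phi> = 0\<close>, where the walk empties the last component, so some intermediate phase
  attains \<open>cmod r\<close>.\<close>

lemma transfer_amplitude:
  fixes r m :: complex
  obtains \<gamma> \<phi> :: real where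
    "cmod (ccos \<gamma> * (\<i> * cis \<phi> * csin \<gamma> + (cis (-\<phi>) - 1) * (cnj r * ccos \<gamma> + cnj m * (\<i> * cis \<phi> * csin \<gamma>)) * m)
       - \<i> * csin \<gamma> * (ccos \<gamma> + (cis (-\<phi>) - 1) * (cnj r * ccos \<gamma> + cnj m * (\<i> * cis \<phi> * csin \<gamma>)) * r)) = cmod r"
proof -
  obtain \<gamma> \<phi>1 :: real where large:
    "cmod r \<le> cmod (ccos \<gamma> * (\<i> * cis \<phi>1 * csin \<gamma> + (cis (-\<phi>1) - 1) * (cnj r * ccos \<gamma> + cnj m * (\<i> * cis \<phi>1 * csin \<gamma>)) * m)
       - \<i> * csin \<gamma> * (ccos \<gamma> + (cis (-\<phi>1) - 1) * (cnj r * ccos \<gamma> + cnj m * (\<i> * cis \<phi>1 * csin \<gamma>)) * r))"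
    by (rule transfer_amplitude_large)
  define f where "f = (\<lambda>\<phi>. cmod (ccos \<gamma> * (\<i> * cis \<phi> * csin \<gamma> + (cis (-\<phi>) - 1) * (cnj r * ccos \<gamma> + cnj m * (\<i> * cis \<phi> * csin \<gamma>)) * m)
       - \<i> * csin \<gamma> * (ccos \<gamma> + (cis (-\<phi>) - 1) * (cnj r * ccos \<gamma> + cnj m * (\<i> * cis \<phi> * csin \<gamma>)) * r)))"
  have "continuous_on UNIV f"
    unfolding f_def by (intro continuous_intros)
  moreover have "f 0 \<le> cmod r"
    by (simp add: f_def algebra_simps)
  moreover have "cmod r \<le> f \<phi>1"
    using large by (simp add: f_def)
  ultimately obtain \<phi> where "f \<phi> = cmod r"
    by (rule intermediate_value_unordered)
  then show ?thesis
    using that unfolding f_def by blast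
qed

section \<open>Assembling the program for both sides\<close>

lemma run_fst_zero:
  assumes "cos \<beta> = 0"
  shows "fst (run \<beta> p (0, Y, z)) = 0"
proof (induction p arbitrary: Y z)
  case Nil
  then show ?case by simp
next
  case (Cons s p)
  have "\<exists>Y' z'. act \<beta> s (0, Y, z) = (0, Y', z')"
    using assms by (cases s) auto
  then show ?case
    using Cons.IH by auto
qed

text \<open>In the cases beyond \<open>steer\<close> the state already has second frame coordinate
  zero, and the empty program suffices.\<close>

lemma steer_side:
  assumes n: "n \<ge> 1" and v: "n \<ge> 3 \<or> n = 1 \<and> X = 0 \<or> X = 0 \<and> Y = 0"
  obtains p \<kappa> y where "quiet p" "run (side_angle n) p (X, Y, z) = frame (side_angle n) \<kappa> 0 y"
    "real (num_search_calls p) \<le> sqrt n + 4"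
proof (cases "n \<ge> 3")
  case True
  obtain p \<kappa> y where "quiet p" "run (side_angle n) p (X, Y, z) = frame (side_angle n) \<kappa> 0 y"
    "real (num_search_calls p) \<le> 1 / side_angle n + 4"
    using side_angle_steerable[OF True] by (rule steer)
  then show ?thesis
    using that[of p \<kappa> y] side_angle(5)[OF n] by simp
next
  case False
  then have "(X, Y, z) = frame (side_angle n) Y 0 z"
    using v side_angle(1,2)[OF n] by (auto simp: frame_def)
  then show ?thesis
    using that[of "[]" Y z] by simp
qed

text \<open>\<open>(0, a, b)\<close> and \<open>(0, b, a)\<close> are one initial state, since a
  triple lists the side of \<open>m\<close> first. Size two is allowed for the second side only if
  the sizes agree, when \<open>w\<close> serves both sides.\<close>

lemma search_both_sides:
  fixes n1 n2 :: nat
  assumes n: "n1 \<ge> 1" "n2 \<ge> 1" and ok: "n2 \<noteq> 2 \<or> n1 = n2"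
  obtains p a b c1 c2 where "(cmod a)\<^sup>2 + (cmod b)\<^sup>2 = 1" "cmod c1 = 1" "cmod c2 = 1"
    "run (side_angle n1) p (0, a, b) = scl c1 (marked (side_angle n1))"
    "run (side_angle n2) p (0, b, a) = scl c2 (marked (side_angle n2))"
    "real (num_search_calls p) \<le> 27 * sqrt (n1 + n2)"
proof -
  let ?\<beta>1 = "side_angle n1" and ?\<beta>2 = "side_angle n2"
  obtain w u where w: "run ?\<beta>1 w (marked ?\<beta>1) = (0, u, 0)" "cmod u = 1"
    "real (num_search_calls w) \<le> sqrt n1 + 4"
    using n(1) by (rule marked_to_uniform)
  obtain s r m where \<eta>: "run ?\<beta>2 w (marked ?\<beta>2) = (s, r, m)"
    by (metis prod.exhaust)
  obtain \<gamma> \<phi> :: real where \<gamma>\<phi>: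
    "cmod (ccos \<gamma> * (\<i> * cis \<phi> * csin \<gamma> + (cis (-\<phi>) - 1) * (cnj r * ccos \<gamma> + cnj m * (\<i> * cis \<phi> * csin \<gamma>)) * m)
       - \<i> * csin \<gamma> * (ccos \<gamma> + (cis (-\<phi>) - 1) * (cnj r * ccos \<gamma> + cnj m * (\<i> * cis \<phi> * csin \<gamma>)) * r)) = cmod r"
    by (rule transfer_amplitude)
  \<comment> \<open>The conjugated search removes \<open>cis \<phi>\<close> on the first uniform
    state; the walk by \<open>\<gamma>\<close> takes the remaining
    \<open>(0, \<i> * sin \<gamma>, cos \<gamma>)\<close> to the second uniform state.\<close>
  define a where "a = \<i> * cis \<phi> * csin \<gamma>"
  define b where "b = ccos \<gamma>"
  define T where "T = (prog_inv w @ [Search \<phi>] @ w) @ [Walk \<gamma>]"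
  have ab: "(cmod a)\<^sup>2 + (cmod b)\<^sup>2 = 1"
    by (simp add: a_def b_def norm_mult)
  have T1: "run ?\<beta>1 T (0, a, b) = (0, 0, 1)"
  proof -
    have "a + (cis (-\<phi>) - 1) * (cnj u * a) * u = a + (cis (-\<phi>) - 1) * a * (cnj u * u)"
      by (simp add: algebra_simps)
    also have "\<dots> = cis (-\<phi>) * a"
      using w(2) by (simp only: cnj_mult_self) (simp add: algebra_simps)
    also have "\<dots> = \<i> * csin \<gamma>"
      by (simp add: a_def mult.left_commute[of "cis _" \<i>] mult.assoc[symmetric] cis_mult)
    finally have "run ?\<beta>1 (prog_inv w @ [Search \<phi>] @ w) (0, a, b) = (0, \<i> * csin \<gamma>, ccos \<gamma>)"
      unfolding run_conjugated_Search w(1) by (simp add: b_def)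
    then have "run ?\<beta>1 T (0, a, b) = act ?\<beta>1 (Walk \<gamma>) (0, \<i> * csin \<gamma>, ccos \<gamma>)"
      unfolding T_def run_simps by simp
    also have "\<dots> = (0, 0, ccos \<gamma> * ccos \<gamma> + csin \<gamma> * csin \<gamma>)"
      by (simp add: algebra_simps)
    finally show ?thesis
      unfolding cos_sin_squares_complex .
  qed
  obtain X2 Y2 z2 where T2: "run ?\<beta>2 T (0, b, a) = (X2, Y2, z2)"
    by (metis prod.exhaust)
  have "run ?\<beta>2 T (0, b, a) = act ?\<beta>2 (Walk \<gamma>) (run ?\<beta>2 (prog_inv w @ [Search \<phi>] @ w) (0, b, a))"
    unfolding T_def run_simps ..
  then have z2: "cmod z2 = cmod r"
    using T2 \<gamma>\<phi> unfolding run_conjugated_Search \<eta> by (auto simp: a_def b_def)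
  \<comment> \<open>The quarter walk sends the image of \<open>m\<close> to the second uniform state
    in the first case, and makes the last amplitude in the second case have modulus
    \<open>cmod r\<close>, as \<open>z2\<close> has.\<close>
  define w' where "w' = w @ [Walk (pi/2)]"
  have w'1: "run ?\<beta>1 w' (marked ?\<beta>1) = (0, 0, -\<i> * u)" and w'2: "run ?\<beta>2 w' (marked ?\<beta>2) = (s, -\<i> * m, -\<i> * r)"
    unfolding w'_def run_simps w \<eta> by simp_all
  have "ip (0, b, a) (0, b, a) = complex_of_real ((cmod a)\<^sup>2 + (cmod b)\<^sup>2)"
    unfolding of_real_add cnj_mult_self[symmetric] by simp
  then have ipT: "ip (X2, Y2, z2) (X2, Y2, z2) = 1"
    using ip_run[of ?\<beta>2 T "(0, b, a)" "(0, b, a)"] ab unfolding T2 by simp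
  have ipw: "ip (s, -\<i> * m, -\<i> * r) (s, -\<i> * m, -\<i> * r) = 1"
    using ip_run[of ?\<beta>2 w' "marked ?\<beta>2" "marked ?\<beta>2"] unfolding w'2 by simp
  \<comment> \<open>The hypotheses of \<open>steer_side\<close> for both states. For equal sizes
    \<open>r = u\<close> has modulus 1, so both states lie entirely on the other uniform
    state.\<close>
  have st: "n2 \<ge> 3 \<or> n2 = 1 \<and> X2 = 0 \<and> s = 0 \<or> X2 = 0 \<and> Y2 = 0 \<and> s = 0 \<and> m = 0"
  proof -
    consider "n2 \<ge> 3" | "n2 = 1" | "n1 = n2"
      using n ok by linarith
    then show ?thesis
    proof cases
      case 2
      then have "cos ?\<beta>2 = 0"
        using side_angle(2)[OF n(2)] by simp
      then have "X2 = 0" "s = 0"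
        using run_fst_zero[of ?\<beta>2 T b a] run_fst_zero[of ?\<beta>2 w "csin ?\<beta>2" 0] T2 \<eta>
        by (auto simp: marked_def)
      then show ?thesis using 2 by simp
    next
      case 3
      then have "s = 0" "r = u" "m = 0"
        using w \<eta> by auto
      then have "cmod z2 = 1" using z2 w by simp
      have "complex_of_real ((cmod X2)\<^sup>2 + (cmod Y2)\<^sup>2 + (cmod z2)\<^sup>2) = complex_of_real 1"
        using ipT unfolding of_real_add cnj_mult_self[symmetric] by simp
      then have "(cmod X2)\<^sup>2 + (cmod Y2)\<^sup>2 + (cmod z2)\<^sup>2 = 1"
        using of_real_eq_iff by blast
      then have "(cmod X2)\<^sup>2 + (cmod Y2)\<^sup>2 = 0"
        using \<open>cmod z2 = 1\<close> by simp
      then have "X2 = 0" "Y2 = 0"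
        by (auto simp: sum_power2_eq_zero_iff)
      then show ?thesis using \<open>s = 0\<close> \<open>m = 0\<close> by simp
    qed simp
  qed
  obtain p1 \<kappa>1 y1 where p1: "quiet p1" "run ?\<beta>2 p1 (X2, Y2, z2) = frame ?\<beta>2 \<kappa>1 0 y1"
    "real (num_search_calls p1) \<le> sqrt n2 + 4"
    using n(2) st by (rule_tac steer_side[of n2 X2 Y2 z2]) auto
  obtain p2 \<kappa>2 y2 where p2: "quiet p2" "run ?\<beta>2 p2 (s, -\<i> * m, -\<i> * r) = frame ?\<beta>2 \<kappa>2 0 y2"
    "real (num_search_calls p2) \<le> sqrt n2 + 4"
    using n(2) st by (rule_tac steer_side[of n2 s "-\<i> * m" "-\<i> * r"]) auto
  have z2': "cmod z2 = cmod (-\<i> * r)"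
    using z2 by (simp add: norm_mult)
  obtain q c where q: "quiet q" "cmod c = 1" "run ?\<beta>2 q (X2, Y2, z2) = scl c (s, -\<i> * m, -\<i> * r)"
    "num_search_calls q = num_search_calls p1 + num_search_calls p2 + 1"
    by (rule connect[OF p1(1,2) p2(1,2) _ z2']) (simp only: ipT ipw)
  \<comment> \<open>In the first case \<open>q\<close> meets a state on the other uniform state
    only, where it is a sign.\<close>
  obtain \<sigma> :: complex where \<sigma>: "\<sigma> * \<sigma> = 1" "run ?\<beta>1 q (0, 0, 1) = (0, 0, \<sigma> * 1)"
    by (rule quiet_run[OF q(1)]) blast
  have "cmod \<sigma> = 1"
    using \<sigma>(1) by (auto simp: square_eq_1_iff)
  define c1 where "c1 = \<sigma> / (- \<i> * u)"
  have c1: "cmod c1 = 1"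
    using \<open>cmod \<sigma> = 1\<close> w(2) by (simp add: c1_def norm_divide norm_mult)
  have "u \<noteq> 0" using w(2) by auto
  then have "(0, 0, \<sigma> * 1) = scl c1 (0, 0, -\<i> * u)"
    by (simp add: c1_def)
  then have r1: "run ?\<beta>1 q (0, 0, 1) = scl c1 (run ?\<beta>1 w' (marked ?\<beta>1))"
    unfolding w'1 \<sigma>(2) .
  have r2: "run ?\<beta>2 q (X2, Y2, z2) = scl c (run ?\<beta>2 w' (marked ?\<beta>2))"
    unfolding w'2 q(3) ..
  let ?p = "T @ q @ prog_inv w'"
  have "real (num_search_calls ?p)
      = 3 * real (num_search_calls w) + real (num_search_calls p1) + real (num_search_calls p2) + 2"
    by (simp add: T_def w'_def q(4))
  also have "\<dots> \<le> 3 * sqrt n1 + 2 * sqrt n2 + 22"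
    using w(3) p1(3) p2(3) by linarith
  \<comment> \<open>\<open>27 = 3 + 2 + 22\<close>, as both square roots and 1 are at most
    \<open>sqrt (n1 + n2)\<close>.\<close>
  also have "\<dots> \<le> 27 * sqrt (n1 + n2)"
  proof -
    have "sqrt n1 \<le> sqrt (n1 + n2)" "sqrt n2 \<le> sqrt (n1 + n2)" "1 \<le> sqrt (n1 + n2)"
      using n by auto
    then show ?thesis by linarith
  qed
  finally have cnt: "real (num_search_calls ?p) \<le> 27 * sqrt (n1 + n2)" .
  have "run ?\<beta>1 ?p (0, a, b) = scl c1 (marked ?\<beta>1)"
    by (simp add: T1 r1 run_scl)
  moreover have "run ?\<beta>2 ?p (0, b, a) = scl c (marked ?\<beta>2)"
    by (simp add: T2 r2 run_scl)
  ultimately show ?thesis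
    using that ab c1 q(2) cnt by blast
qed

text \<open>If size two forbids one order of the sides, the other is allowed; exchanging the sides
  exchanges \<open>a\<close> and \<open>b\<close>.\<close>

corollary search_both_sides':
  fixes n1 n2 :: nat
  assumes n: "n1 \<ge> 1" "n2 \<ge> 1"
  obtains p a b c1 c2 where "(cmod a)\<^sup>2 + (cmod b)\<^sup>2 = 1" "cmod c1 = 1" "cmod c2 = 1"
    "run (side_angle n1) p (0, a, b) = scl c1 (marked (side_angle n1))"
    "run (side_angle n2) p (0, b, a) = scl c2 (marked (side_angle n2))"
    "real (num_search_calls p) \<le> 27 * sqrt (n1 + n2)"
proof (cases "n2 \<noteq> 2 \<or> n1 = n2")
  case True
  then show ?thesis
    using search_both_sides[OF n] that by metis
next
  case False
  then have "n1 \<noteq> 2 \<or> n2 = n1" by auto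
  then obtain p a b c1 c2 where "(cmod a)\<^sup>2 + (cmod b)\<^sup>2 = 1" "cmod c1 = 1" "cmod c2 = 1"
    "run (side_angle n2) p (0, a, b) = scl c1 (marked (side_angle n2))"
    "run (side_angle n1) p (0, b, a) = scl c2 (marked (side_angle n1))"
    "real (num_search_calls p) \<le> 27 * sqrt (n2 + n1)"
    using search_both_sides[OF n(2,1)] by metis
  then show ?thesis
    using that[of b a c2 c1 p] by (simp add: add.commute)
qed

section \<open>The invariant subspace of the complete bipartite graph\<close>

definition side :: "nat \<Rightarrow> nat \<Rightarrow> bool \<Rightarrow> nat set" where
  "side N1 N2 b = {v \<in> kb_vertices N1 N2. (v < N1) = b}"

definition side_size :: "nat \<Rightarrow> nat \<Rightarrow> bool \<Rightarrow> nat" where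
  "side_size N1 N2 b = (if b then N1 else N2)"

definition unif :: "nat \<Rightarrow> nat \<Rightarrow> bool \<Rightarrow> state" where
  "unif N1 N2 b v = (if v \<in> side N1 N2 b then complex_of_real (1 / sqrt (side_size N1 N2 b)) else 0)"

text \<open>The unit vector on the side of \<open>m\<close> that is orthogonal to the uniform state and has the
  largest overlap with \<open>m\<close>; it vanishes when \<open>m\<close> is alone on its side.\<close>

definition perp :: "nat \<Rightarrow> nat \<Rightarrow> nat \<Rightarrow> state" where
  "perp N1 N2 m v = (let n = side_size N1 N2 (m < N1) in
     if v = m then ccos (side_angle n)
     else if v \<in> side N1 N2 (m < N1) then - complex_of_real (1 / sqrt (real n * (real n - 1))) else 0)"

fun lift :: "nat \<Rightarrow> nat \<Rightarrow> nat \<Rightarrow> amps \<Rightarrow> state" where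
  "lift N1 N2 m (X, Y, z) = (\<lambda>v. X * perp N1 N2 m v + Y * unif N1 N2 (m < N1) v + z * unif N1 N2 (\<not> m < N1) v)"

lemma finite_side [simp]: "finite (side N1 N2 b)"
  by (simp add: side_def kb_vertices_def)

lemma card_side [simp]: "card (side N1 N2 b) = side_size N1 N2 b"
proof (cases b)
  case True
  then have "side N1 N2 b = {0..<N1}" by (auto simp: side_def kb_vertices_def)
  then show ?thesis using True by (simp add: side_size_def)
next
  case False
  then have "side N1 N2 b = {N1..<N1 + N2}" by (auto simp: side_def kb_vertices_def)
  then show ?thesis using False by (simp add: side_size_def)
qed

lemma adj_op_eq_sum_side:
  "adj_op N1 N2 \<psi> v = (if v \<in> kb_vertices N1 N2 then (\<Sum>u\<in>side N1 N2 (\<not> v < N1). \<psi> u) else 0)"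
proof (cases "v \<in> kb_vertices N1 N2")
  case True
  then have "adj_op N1 N2 \<psi> v = (\<Sum>u\<in>kb_vertices N1 N2. if (u < N1) = (\<not> v < N1) then \<psi> u else 0)"
    unfolding adj_op_def by (intro sum.cong) (auto simp: kb_adj_def)
  also have "\<dots> = (\<Sum>u\<in>side N1 N2 (\<not> v < N1). \<psi> u)"
    unfolding side_def by (rule sum.inter_filter[symmetric]) (simp add: kb_vertices_def)
  finally show ?thesis
    using True by simp
next
  case False
  then show ?thesis
    by (simp add: adj_op_def kb_adj_def)
qed

lemma sum_unif: "(\<Sum>u\<in>side N1 N2 c. unif N1 N2 b u) = (if c = b then complex_of_real (sqrt (side_size N1 N2 b)) else 0)"
proof (cases "c = b")
  case True
  have "(\<Sum>u\<in>side N1 N2 b. unif N1 N2 b u) = complex_of_real (side_size N1 N2 b * (1 / sqrt (side_size N1 N2 b)))"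
    by (simp add: unif_def)
  then show ?thesis
    using True by (simp add: real_div_sqrt)
next
  case False
  then have "unif N1 N2 b u = 0" if "u \<in> side N1 N2 c" for u
    using that by (auto simp: unif_def side_def)
  then show ?thesis
    using False by simp
qed

text \<open>The first equation makes \<open>perp\<close> sum to zero; the second cancels the marked
  vector at the other vertices of its side.\<close>

lemma perp_amplitude:
  assumes "n \<ge> 1"
  shows "cos (side_angle n) = (real n - 1) * (1 / sqrt (real n * (real n - 1)))"
    "n \<ge> 2 \<Longrightarrow> cos (side_angle n) * (1 / sqrt (real n * (real n - 1))) = 1 / n"
proof -
  have c: "cos (side_angle n) = sqrt (real n - 1) / sqrt n"
    using assms by (simp add: side_angle real_sqrt_divide[symmetric] diff_divide_distrib)
  have e: "sqrt (real n * (real n - 1)) = sqrt n * sqrt (real n - 1)"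
    using assms by (simp add: real_sqrt_mult of_nat_diff)
  have "(real n - 1) / sqrt (real n - 1) = sqrt (real n - 1)"
    using assms by (intro real_div_sqrt) simp
  then show "cos (side_angle n) = (real n - 1) * (1 / sqrt (real n * (real n - 1)))"
    unfolding c e by (simp add: divide_divide_eq_left' divide_simps)
  show "cos (side_angle n) * (1 / sqrt (real n * (real n - 1))) = 1 / n" if "n \<ge> 2"
    unfolding c e using that by (simp add: field_simps flip: power2_eq_square)
qed

lemma sum_perp:
  assumes "m \<in> kb_vertices N1 N2"
  shows "(\<Sum>u\<in>side N1 N2 c. perp N1 N2 m u) = 0"
proof (cases "c = (m < N1)")
  case True
  let ?S = "side N1 N2 (m < N1)" and ?n = "side_size N1 N2 (m < N1)"
  have m: "m \<in> ?S"
    using assms by (simp add: side_def)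
  then have "?n \<ge> 1"
    by (metis One_nat_def Suc_leI card_gt_0_iff card_side empty_iff finite_side)
  have "(\<Sum>u\<in>?S. perp N1 N2 m u) = perp N1 N2 m m + (\<Sum>u\<in>?S - {m}. perp N1 N2 m u)"
    using m by (simp add: sum.remove)
  also have "(\<Sum>u\<in>?S - {m}. perp N1 N2 m u) = (\<Sum>u\<in>?S - {m}. - complex_of_real (1 / sqrt (real ?n * (real ?n - 1))))"
    by (intro sum.cong) (auto simp: perp_def Let_def)
  also have "\<dots> = - complex_of_real ((real ?n - 1) * (1 / sqrt (real ?n * (real ?n - 1))))"
    using m \<open>?n \<ge> 1\<close> by (simp add: of_nat_diff)
  also have "perp N1 N2 m m = complex_of_real (cos (side_angle ?n))"
    by (simp add: perp_def Let_def)
  finally show ?thesis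
    unfolding perp_amplitude(1)[OF \<open>?n \<ge> 1\<close>] using True by simp
next
  case False
  then have "perp N1 N2 m u = 0" if "u \<in> side N1 N2 c" for u
    using that assms by (auto simp: perp_def side_def Let_def)
  then show ?thesis by simp
qed

text \<open>The adjacency operator sees only the sums over the sides: \<open>perp\<close> has sum
  zero, and the uniform states are exchanged with factor \<open>\<omega>\<close>.\<close>

lemma adj_op_lift:
  assumes "m \<in> kb_vertices N1 N2" "N1 \<ge> 1" "N2 \<ge> 1"
  defines "\<omega> \<equiv> complex_of_real (sqrt (real N1 * real N2))"
  shows "adj_op N1 N2 (lift N1 N2 m (X, Y, z)) = lift N1 N2 m (0, \<omega> * z, \<omega> * Y)"
proof
  fix v
  have \<omega>: "\<omega> * complex_of_real (1 / sqrt (side_size N1 N2 b)) = complex_of_real (sqrt (side_size N1 N2 (\<not> b)))" for b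
    using assms unfolding \<omega>_def side_size_def
    by (simp add: real_sqrt_mult flip: of_real_mult of_real_divide)
  have U: "unif N1 N2 b v = (if v \<in> kb_vertices N1 N2 \<and> (v < N1) = b then complex_of_real (1 / sqrt (side_size N1 N2 b)) else 0)" for b
    by (simp add: unif_def side_def)
  have S: "(\<Sum>u\<in>side N1 N2 c. lift N1 N2 m (X, Y, z) u)
     = Y * (if c = (m < N1) then complex_of_real (sqrt (side_size N1 N2 (m < N1))) else 0)
     + z * (if c = (\<not> m < N1) then complex_of_real (sqrt (side_size N1 N2 (\<not> m < N1))) else 0)" for c
    by (simp add: sum.distrib sum_perp[OF assms(1)] sum_unif flip: sum_distrib_left)
  show "adj_op N1 N2 (lift N1 N2 m (X, Y, z)) v = lift N1 N2 m (0, \<omega> * z, \<omega> * Y) v"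
    unfolding adj_op_eq_sum_side S unfolding lift.simps U using \<omega>[of "m < N1"] \<omega>[of "\<not> m < N1"]
    by (auto simp: mult.assoc mult.left_commute[of \<omega>])
qed

section \<open>The exponentials on the invariant subspace\<close>

lemma exp_sums_fact: "(\<lambda>k. x ^ k / of_nat (fact k)) sums exp (x::complex)"
  using exp_converges[of x] by (simp add: scaleR_conv_of_real divide_inverse mult.commute)

lemma walk_op_lift:
  assumes m: "m \<in> kb_vertices N1 N2" "N1 \<ge> 1" "N2 \<ge> 1"
  shows "walk_op N1 N2 (a / sqrt (real N1 * real N2)) (lift N1 N2 m t) = lift N1 N2 m (act \<beta> (Walk a) t)"
proof
  fix v
  obtain X Y z where t: "t = (X, Y, z)"
    by (metis prod.exhaust)
  define \<omega> where "\<omega> = sqrt (real N1 * real N2)"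
  define H where "H = (\<lambda>\<psi> v. - \<i> * complex_of_real (a / \<omega>) * adj_op N1 N2 \<psi> v)"
  define \<mu> where "\<mu> = - \<i> * complex_of_real a"
  have "\<omega> > 0"
    using m by (simp add: \<omega>_def)
  have H: "H (lift N1 N2 m (X, Y, z)) = lift N1 N2 m (0, \<mu> * z, \<mu> * Y)" for X Y z
    unfolding H_def adj_op_lift[OF m] \<omega>_def[symmetric] \<mu>_def using \<open>\<omega> > 0\<close>
    by (auto simp: fun_eq_iff algebra_simps)
  \<comment> \<open>\<open>Y + z\<close> and \<open>Y - z\<close> belong to the eigenvalues
    \<open>\<mu>\<close> and \<open>-\<mu>\<close>; \<open>0 ^ k\<close> keeps \<open>X\<close> at
    \<open>k = 0\<close> only.\<close>
  have pow: "(H ^^ k) (lift N1 N2 m (X, Y, z)) = lift N1 N2 m (0 ^ k * X,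
      (\<mu> ^ k * (Y + z) + (-\<mu>) ^ k * (Y - z)) / 2, (\<mu> ^ k * (Y + z) - (-\<mu>) ^ k * (Y - z)) / 2)" for k
  proof (induction k)
    case 0
    then show ?case by simp
  next
    case (Suc k)
    show ?case
      unfolding funpow.simps comp_def Suc.IH H
      by (rule arg_cong[where f = "lift N1 N2 m"]) (simp add: algebra_simps add_divide_distrib)
  qed
  let ?P = "perp N1 N2 m v" and ?U = "unif N1 N2 (m < N1) v" and ?W = "unif N1 N2 (\<not> m < N1) v"
  have "(\<lambda>k. (0 ^ k / of_nat (fact k)) * (X * ?P) + (\<mu> ^ k / of_nat (fact k)) * ((Y + z) / 2 * (?U + ?W))
      + ((-\<mu>) ^ k / of_nat (fact k)) * ((Y - z) / 2 * (?U - ?W)))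
      sums (exp 0 * (X * ?P) + exp \<mu> * ((Y + z) / 2 * (?U + ?W)) + exp (-\<mu>) * ((Y - z) / 2 * (?U - ?W)))"
    by (intro sums_add sums_mult2 exp_sums_fact)
  moreover have "(H ^^ k) (lift N1 N2 m (X, Y, z)) v / of_nat (fact k)
      = (0 ^ k / of_nat (fact k)) * (X * ?P) + (\<mu> ^ k / of_nat (fact k)) * ((Y + z) / 2 * (?U + ?W))
      + ((-\<mu>) ^ k / of_nat (fact k)) * ((Y - z) / 2 * (?U - ?W))" for k
    unfolding pow by (simp add: field_simps)
  ultimately have "op_exp H (lift N1 N2 m (X, Y, z)) v
      = X * ?P + exp \<mu> * ((Y + z) / 2 * (?U + ?W)) + exp (-\<mu>) * ((Y - z) / 2 * (?U - ?W))"
    unfolding op_exp_def by (simp add: sums_iff)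
  also have "exp \<mu> = ccos a - \<i> * csin a"
    using cis_conv_exp[of "-a"] by (simp add: \<mu>_def complex_eq_iff)
  also have "exp (-\<mu>) = ccos a + \<i> * csin a"
    using cis_conv_exp[of a] by (simp add: \<mu>_def complex_eq_iff)
  also have "X * ?P + (ccos a - \<i> * csin a) * ((Y + z) / 2 * (?U + ?W))
      + (ccos a + \<i> * csin a) * ((Y - z) / 2 * (?U - ?W)) = lift N1 N2 m (act \<beta> (Walk a) (X, Y, z)) v"
    by (simp add: field_simps)
  finally show "walk_op N1 N2 (a / sqrt (real N1 * real N2)) (lift N1 N2 m t) v = lift N1 N2 m (act \<beta> (Walk a) t) v"
    unfolding walk_op_def H_def \<omega>_def t .
qed

lemma search_op_eq: "search_op m \<theta> \<psi> v = (if v = m then cis (-\<theta>) * \<psi> m else \<psi> v)"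
proof -
  define \<mu> where "\<mu> = - \<i> * complex_of_real \<theta>"
  define H where "H = (\<lambda>(\<psi>::state) v. \<mu> * (if v = m then \<psi> m else 0))"
  have pow: "(H ^^ k) \<psi> v = (if v = m then \<mu> else 0) ^ k * \<psi> v" for k v
    by (induction k arbitrary: v) (simp_all add: H_def)
  have "(\<lambda>k. (H ^^ k) \<psi> v / of_nat (fact k)) sums (exp (if v = m then \<mu> else 0) * \<psi> v)"
    unfolding pow using sums_mult2[OF exp_sums_fact[of "if v = m then \<mu> else 0"], of "\<psi> v"] by simp
  then have "op_exp H \<psi> v = exp (if v = m then \<mu> else 0) * \<psi> v"
    unfolding op_exp_def by (simp add: sums_iff)
  moreover have "exp \<mu> = cis (-\<theta>)"
    by (simp add: cis_conv_exp \<mu>_def)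
  ultimately show ?thesis
    unfolding search_op_def H_def \<mu>_def by simp
qed

lemma lift_marked:
  assumes "m \<in> kb_vertices N1 N2"
  shows "lift N1 N2 m (marked (side_angle (side_size N1 N2 (m < N1)))) v = (if v = m then 1 else 0)"
proof -
  let ?S = "side N1 N2 (m < N1)" and ?n = "side_size N1 N2 (m < N1)"
  have m: "m \<in> ?S"
    using assms by (simp add: side_def)
  then have n: "?n \<ge> 1"
    by (metis One_nat_def Suc_leI card_gt_0_iff card_side empty_iff finite_side)
  consider "v = m" | "v \<in> ?S" "v \<noteq> m" | "v \<notin> ?S"
    by blast
  then show ?thesis
  proof cases
    case 1
    then show ?thesis
      using m cos_sin_squares_complex[of "side_angle ?n"]
      by (simp add: marked_def perp_def unif_def side_angle(1)[OF n] Let_def)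
  next
    case 2
    have "card {m, v} \<le> card ?S"
      using m 2 by (intro card_mono) auto
    then have "?n \<ge> 2"
      using 2 by simp
    have "lift N1 N2 m (marked (side_angle ?n)) v
        = complex_of_real (sin (side_angle ?n) * (1 / sqrt ?n) - cos (side_angle ?n) * (1 / sqrt (real ?n * (real ?n - 1))))"
      using 2 by (simp add: marked_def perp_def unif_def Let_def)
    also have "\<dots> = 0"
      unfolding perp_amplitude(2)[OF n \<open>?n \<ge> 2\<close>] side_angle(1)[OF n] by simp
    finally show ?thesis using 2 by simp
  next
    case 3
    then show ?thesis
      using m by (auto simp: marked_def perp_def unif_def Let_def)
  qed
qed

text \<open>The value at \<open>m\<close> is the inner product with the marked vector, whose lift is
  the basis state of \<open>m\<close>; so the rank-one form of a search carries over.\<close>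

lemma search_op_lift:
  assumes m: "m \<in> kb_vertices N1 N2"
  shows "search_op m \<theta> (lift N1 N2 m t) = lift N1 N2 m (act (side_angle (side_size N1 N2 (m < N1))) (Search \<theta>) t)"
proof
  fix v
  let ?\<beta> = "side_angle (side_size N1 N2 (m < N1))"
  obtain X Y z where t: "t = (X, Y, z)"
    by (metis prod.exhaust)
  have lin: "lift N1 N2 m (u + scl c w) v = lift N1 N2 m u v + c * lift N1 N2 m w v" for u c w v
    by (cases u; cases w) (simp add: algebra_simps)
  have n: "side_size N1 N2 (m < N1) \<ge> 1"
    using m by (auto simp: side_size_def kb_vertices_def)
  have at_m: "lift N1 N2 m t m = ip (marked ?\<beta>) t"
    using m n by (simp add: t marked_def perp_def unif_def side_def Let_def side_angle(1))
  show "search_op m \<theta> (lift N1 N2 m t) v = lift N1 N2 m (act ?\<beta> (Search \<theta>) t) v"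
    unfolding search_op_eq act_Search_marked lin lift_marked[OF m] at_m[symmetric]
    by (simp add: algebra_simps)
qed

section \<open>From programs on triples to algorithms on the graph\<close>

fun rescale :: "real \<Rightarrow> step \<Rightarrow> step" where
  "rescale \<omega> (Walk a) = Walk (a / \<omega>)"
| "rescale \<omega> (Search \<theta>) = Search \<theta>"

lemma num_search_calls_rescale [simp]: "num_search_calls (map (rescale \<omega>) p) = num_search_calls p"
proof (induction p)
  case (Cons s p)
  then show ?case by (cases s) simp_all
qed simp

text \<open>Walk angles are times multiplied by \<open>sqrt (real N1 * real N2)\<close>, and
  \<open>rescale\<close> divides by this factor.\<close>

lemma run_alg_lift:
  assumes m: "m \<in> kb_vertices N1 N2" "N1 \<ge> 1" "N2 \<ge> 1"
  shows "run_alg N1 N2 m (map (rescale (sqrt (real N1 * real N2))) p) (lift N1 N2 m t)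
    = lift N1 N2 m (run (side_angle (side_size N1 N2 (m < N1))) p t)"
proof (induction p arbitrary: t)
  case Nil
  then show ?case by (simp add: run_alg_def)
next
  case (Cons s p)
  have "apply_step N1 N2 m (rescale (sqrt (real N1 * real N2)) s) (lift N1 N2 m t)
      = lift N1 N2 m (act (side_angle (side_size N1 N2 (m < N1))) s t)"
    by (cases s) (simp_all add: walk_op_lift[OF m] search_op_lift[OF m(1)])
  then show ?case
    using Cons.IH by (simp add: run_alg_def)
qed

lemma valid_init_unif:
  assumes "N1 \<ge> 1" "N2 \<ge> 1" "(cmod a)\<^sup>2 + (cmod b)\<^sup>2 = 1"
  shows "valid_init N1 N2 (\<lambda>v. a * unif N1 N2 True v + b * unif N1 N2 False v)"
proof -
  let ?\<psi> = "\<lambda>v. a * unif N1 N2 True v + b * unif N1 N2 False v"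
  have V: "kb_vertices N1 N2 = side N1 N2 True \<union> side N1 N2 False"
    by (auto simp: side_def)
  have "(\<Sum>v\<in>kb_vertices N1 N2. (cmod (?\<psi> v))\<^sup>2)
      = (\<Sum>v\<in>side N1 N2 True. (cmod (?\<psi> v))\<^sup>2) + (\<Sum>v\<in>side N1 N2 False. (cmod (?\<psi> v))\<^sup>2)"
    unfolding V by (rule sum.union_disjoint) (auto simp: side_def kb_vertices_def)
  also have "(\<Sum>v\<in>side N1 N2 True. (cmod (?\<psi> v))\<^sup>2) = (\<Sum>v\<in>side N1 N2 True. (cmod a)\<^sup>2 / N1)"
    by (intro sum.cong refl) (auto simp: unif_def side_def side_size_def norm_divide power_divide)
  also have "(\<Sum>v\<in>side N1 N2 False. (cmod (?\<psi> v))\<^sup>2) = (\<Sum>v\<in>side N1 N2 False. (cmod b)\<^sup>2 / N2)"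
    by (intro sum.cong refl) (auto simp: unif_def side_def side_size_def norm_divide power_divide)
  finally have "(\<Sum>v\<in>kb_vertices N1 N2. (cmod (?\<psi> v))\<^sup>2) = 1"
    using assms by (simp add: side_size_def)
  then show ?thesis
    by (auto simp: valid_init_def unif_def side_def)
qed

theorem theorem3:
  shows "\<exists>C::real. C > 0 \<and>
    (\<forall>N1 N2 :: nat. N1 \<ge> 1 \<longrightarrow> N2 \<ge> 1 \<longrightarrow>
      (\<exists>\<psi>0 ops. valid_init N1 N2 \<psi>0
         \<and> real (num_search_calls ops) \<le> C * sqrt (real (N1 + N2))
         \<and> (\<forall>m\<in>kb_vertices N1 N2. (cmod (run_alg N1 N2 m ops \<psi>0 m))\<^sup>2 = 1)))"
proof (intro exI[of _ 27] conjI allI impI)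
  fix N1 N2 :: nat
  assume N: "N1 \<ge> 1" "N2 \<ge> 1"
  obtain p a b c1 c2 where ab: "(cmod a)\<^sup>2 + (cmod b)\<^sup>2 = 1" and c: "cmod c1 = 1" "cmod c2 = 1"
    and r1: "run (side_angle N1) p (0, a, b) = scl c1 (marked (side_angle N1))"
    and r2: "run (side_angle N2) p (0, b, a) = scl c2 (marked (side_angle N2))"
    and cnt: "real (num_search_calls p) \<le> 27 * sqrt (N1 + N2)"
    using N by (rule search_both_sides')
  let ?\<psi> = "\<lambda>v. a * unif N1 N2 True v + b * unif N1 N2 False v"
  let ?ops = "map (rescale (sqrt (real N1 * real N2))) p"
  have "(cmod (run_alg N1 N2 m ?ops ?\<psi> m))\<^sup>2 = 1" if m: "m \<in> kb_vertices N1 N2" for m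
  proof -
    let ?\<beta> = "side_angle (side_size N1 N2 (m < N1))"
    \<comment> \<open>The same initial state with the side of \<open>m\<close> listed first; state
      and program were fixed before \<open>m\<close>.\<close>
    define t :: amps where "t = (if m < N1 then (0, a, b) else (0, b, a))"
    obtain c where c: "cmod c = 1" "run ?\<beta> p t = scl c (marked ?\<beta>)"
      using c r1 r2 that by (cases "m < N1") (auto simp: t_def side_size_def)
    have "?\<psi> = lift N1 N2 m t"
      by (auto simp: t_def fun_eq_iff)
    then have "run_alg N1 N2 m ?ops ?\<psi> m = lift N1 N2 m (scl c (marked ?\<beta>)) m"
      using run_alg_lift[OF m N, of p t] c(2) by simp
    also have "\<dots> = c * lift N1 N2 m (marked ?\<beta>) m"
      by (cases "marked ?\<beta>") (simp add: algebra_simps)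
    finally show ?thesis
      using c(1) lift_marked[OF m, of m] by simp
  qed
  then show "\<exists>\<psi>0 ops. valid_init N1 N2 \<psi>0 \<and> real (num_search_calls ops) \<le> 27 * sqrt (real (N1 + N2))
      \<and> (\<forall>m\<in>kb_vertices N1 N2. (cmod (run_alg N1 N2 m ops \<psi>0 m))\<^sup>2 = 1)"
    using valid_init_unif[OF N ab] cnt by (intro exI[of _ ?\<psi>] exI[of _ ?ops]) simp
qed simp

end
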